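(* Let $r\ge 0$ be an integer and let $u\in H^r(a,b)$ be given. For any $q=0,\ldots,r$, let $Q_t^q$ be the projector onto $\mathcal{Z}_t$ defined in the context. Then, for any $\ell=0,\ldots,q$, we have $$\|\partial^{\ell}(u-Q^q_t u)\|\leq \mathfrak{C}_{t-q,q-\ell}\, \mathfrak{C}_{t-q,r-q}\,\|\partial^r u\|,$$ for all $t\geq q$ such that $\mathcal{P}_{r-q-1}\subseteq\mathcal{Z}_{t-q}$ and $\mathcal{P}_{q-\ell-1}\subseteq\mathcal{Z}_{t-q}$.
   Context: Let $a<b$ be real. $\|\cdot\|$ and $(\cdot,\cdot)$ denote the norm and inner product of the real space $L^2(a,b)$ (and $\|\cdot\|$ also the corresponding operator norm). $\partial$ is the (weak) derivative, $H^r(a,b)=\{u\in L^2(a,b):\partial^\alpha u\in L^2(a,b),\ \alpha=1,\ldots,r\}$, $H^0(a,b)=L^2(a,b)$; for $u\in H^1(a,b)$ point values are those of the continuous representative. $\mathcal{P}_k$ is the space of polynomials of degree at most $k$ (restricted to $[a,b]$), and $\mathcal{P}_{k}=\{0\}$ for $k<0$. Define $(Kf)(x)=\int_a^x f(y)\,dy$ and its $L^2$-adjoint $(K^*f)(x)=\int_x^b f(y)\,dy$. Let $\mathcal{Z}_0\supseteq\mathcal{P}_0$ be any finite dimensional subspace of $L^2(a,b)$ and for integers $t\ge 1$ let $\mathcal{Z}_t:=\mathcal{P}_0+K(\mathcal{Z}_{t-1})$, where it is assumed that $\mathcal{P}_0+K(\mathcal{Z}_{t-1})=\mathcal{P}_0+K^*(\mathcal{Z}_{t-1})$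 (sums need not be direct). Let $Z_t$ be the $L^2(a,b)$-orthogonal projector onto $\mathcal{Z}_t$, and for integers $t,s\ge0$ let $\mathfrak{C}_{t,s}:=\|(I-Z_t)K^s\|$ (operator norm on $L^2(a,b)$; $K^0=I$). The projectors $Q_t^q:H^q(a,b)\to\mathcal{Z}_t$, $q=0,\ldots,t$, are defined recursively by $Q_t^0:=Z_t$ and, for $q\ge1$, $Q_t^q u:=u(a)+KQ_{t-1}^{q-1}\partial u$. *)

theory Defs
  imports "HOL-Analysis.Analysis" "HOL-Computational_Algebra.Polynomial"
begin

text \<open>
  Elements of \<open>L\<^sup>2(a,b)\<close> are represented by functions \<open>real \<Rightarrow> real\<close> whose values outside the
  open interval are irrelevant, and equality in \<open>L\<^sup>2(a,b)\<close> is equality almost everywhere on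
  \<open>(a,b)\<close>. Linear subspaces of \<open>L\<^sup>2(a,b)\<close> are represented by sets of functions that are closed
  under almost everywhere equality, so that inclusion and equality of such sets are inclusion
  and equality of the subspaces.
\<close>

definition L2 :: "real \<Rightarrow> real \<Rightarrow> (real \<Rightarrow> real) set" where
  "L2 a b = {f \<in> borel_measurable (lebesgue_on {a<..<b}).
               integrable (lebesgue_on {a<..<b}) (\<lambda>x. (f x)\<^sup>2)}"

definition L2_inner :: "real \<Rightarrow> real \<Rightarrow> (real \<Rightarrow> real) \<Rightarrow> (real \<Rightarrow> real) \<Rightarrow> real" where
  "L2_inner a b f g = (LINT x|lebesgue_on {a<..<b}. f x * g x)"

definition L2_norm :: "real \<Rightarrow> real \<Rightarrow> (real \<Rightarrow> real) \<Rightarrow> real" where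
  "L2_norm a b f = sqrt (L2_inner a b f f)"

definition L2_eq :: "real \<Rightarrow> real \<Rightarrow> (real \<Rightarrow> real) \<Rightarrow> (real \<Rightarrow> real) \<Rightarrow> bool" where
  "L2_eq a b f g \<longleftrightarrow> (AE x in lebesgue_on {a<..<b}. f x = g x)"

definition L2_saturate :: "real \<Rightarrow> real \<Rightarrow> (real \<Rightarrow> real) set \<Rightarrow> (real \<Rightarrow> real) set" where
  "L2_saturate a b A = {f \<in> L2 a b. \<exists>g\<in>A. L2_eq a b f g}"

definition L2_sum :: "real \<Rightarrow> real \<Rightarrow> (real \<Rightarrow> real) set \<Rightarrow> (real \<Rightarrow> real) set \<Rightarrow> (real \<Rightarrow> real) set" where
  "L2_sum a b A B = L2_saturate a b {(\<lambda>x. f x + g x) | f g. f \<in> A \<and> g \<in> B}"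

definition L2_span :: "real \<Rightarrow> real \<Rightarrow> (real \<Rightarrow> real) set \<Rightarrow> (real \<Rightarrow> real) set" where
  "L2_span a b B = L2_saturate a b {(\<lambda>x. \<Sum>g\<in>B. c g * g x) | c. True}"

definition finite_dim_subspace :: "real \<Rightarrow> real \<Rightarrow> (real \<Rightarrow> real) set \<Rightarrow> bool" where
  "finite_dim_subspace a b V \<longleftrightarrow> (\<exists>B. finite B \<and> B \<subseteq> L2 a b \<and> V = L2_span a b B)"

text \<open>The index is an integer; for negative \<open>k\<close> only the zero polynomial remains.\<close>

definition poly_space :: "real \<Rightarrow> real \<Rightarrow> int \<Rightarrow> (real \<Rightarrow> real) set" where
  "poly_space a b k = L2_saturate a b {poly p | p. p = 0 \<or> int (degree p) \<le> k}"

text \<open>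
  The predicate \<open>\<lambda>p. p \<in> V \<and> \<dots>\<close> depends on \<open>f\<close> only through its almost everywhere class, and
  so does the chosen representative of the projection.
\<close>

definition orth_proj ::
    "real \<Rightarrow> real \<Rightarrow> (real \<Rightarrow> real) set \<Rightarrow> (real \<Rightarrow> real) \<Rightarrow> (real \<Rightarrow> real)" where
  "orth_proj a b V f = (SOME p. p \<in> V \<and> (\<forall>v\<in>V. L2_inner a b (\<lambda>x. f x - p x) v = 0))"

definition L2_opnorm :: "real \<Rightarrow> real \<Rightarrow> ((real \<Rightarrow> real) \<Rightarrow> (real \<Rightarrow> real)) \<Rightarrow> real" where
  "L2_opnorm a b T = (SUP f\<in>{f \<in> L2 a b. L2_norm a b f \<le> 1}. L2_norm a b (T f))"

definition test_fun :: "real \<Rightarrow> real \<Rightarrow> (real \<Rightarrow> real) \<Rightarrow> bool" where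
  "test_fun a b \<phi> \<longleftrightarrow>
     (\<forall>n x. (deriv ^^ n) \<phi> differentiable (at x)) \<and>
     compact (closure {x. \<phi> x \<noteq> 0}) \<and> closure {x. \<phi> x \<noteq> 0} \<subseteq> {a<..<b}"

definition has_weak_deriv ::
    "real \<Rightarrow> real \<Rightarrow> nat \<Rightarrow> (real \<Rightarrow> real) \<Rightarrow> (real \<Rightarrow> real) \<Rightarrow> bool" where
  "has_weak_deriv a b n u v \<longleftrightarrow> u \<in> L2 a b \<and> v \<in> L2 a b \<and>
     (\<forall>\<phi>. test_fun a b \<phi> \<longrightarrow> L2_inner a b u ((deriv ^^ n) \<phi>) = (-1) ^ n * L2_inner a b v \<phi>)"

text \<open>
  The weak derivative of order \<open>n\<close>; it is meaningful (and then unique up to almost everywhere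
  equality) when \<open>u\<close> has such a derivative in \<open>L\<^sup>2(a,b)\<close>.
\<close>

definition weak_deriv :: "real \<Rightarrow> real \<Rightarrow> nat \<Rightarrow> (real \<Rightarrow> real) \<Rightarrow> (real \<Rightarrow> real)" where
  "weak_deriv a b n u = (SOME v. has_weak_deriv a b n u v)"

definition Sobolev :: "real \<Rightarrow> real \<Rightarrow> nat \<Rightarrow> (real \<Rightarrow> real) set" where
  "Sobolev a b r = {u \<in> L2 a b. \<forall>n\<in>{1..r}. \<exists>v. has_weak_deriv a b n u v}"

text \<open>Value at \<open>x \<in> [a,b]\<close> of the continuous representative of \<open>u\<close>.\<close>

definition point_value :: "real \<Rightarrow> real \<Rightarrow> (real \<Rightarrow> real) \<Rightarrow> real \<Rightarrow> real" where
  "point_value a b u x = (THE c. \<exists>v. continuous_on {a..b} v \<and> L2_eq a b u v \<and> v x = c)"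

definition K_op :: "real \<Rightarrow> (real \<Rightarrow> real) \<Rightarrow> (real \<Rightarrow> real)" where
  "K_op a f = (\<lambda>x. LINT y:{a..x}|lebesgue. f y)"

definition K_adj :: "real \<Rightarrow> (real \<Rightarrow> real) \<Rightarrow> (real \<Rightarrow> real)" where
  "K_adj b f = (\<lambda>x. LINT y:{x..b}|lebesgue. f y)"

primrec Z_space :: "real \<Rightarrow> real \<Rightarrow> (real \<Rightarrow> real) set \<Rightarrow> nat \<Rightarrow> (real \<Rightarrow> real) set" where
  "Z_space a b Z0 0 = Z0"
| "Z_space a b Z0 (Suc t) = L2_sum a b (poly_space a b 0) (K_op a ` Z_space a b Z0 t)"

definition Z_proj ::
    "real \<Rightarrow> real \<Rightarrow> (real \<Rightarrow> real) set \<Rightarrow> nat \<Rightarrow> (real \<Rightarrow> real) \<Rightarrow> (real \<Rightarrow> real)" where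
  "Z_proj a b Z0 t = orth_proj a b (Z_space a b Z0 t)"

definition C_const :: "real \<Rightarrow> real \<Rightarrow> (real \<Rightarrow> real) set \<Rightarrow> nat \<Rightarrow> nat \<Rightarrow> real" where
  "C_const a b Z0 t s =
     L2_opnorm a b (\<lambda>f x. (K_op a ^^ s) f x - Z_proj a b Z0 t ((K_op a ^^ s) f) x)"

text \<open>
  \<open>Q_proj a b Z0 q t\<close> is the projector of \<open>H\<^sup>q(a,b)\<close> onto the space with index \<open>t\<close>. It is only
  meaningful for \<open>q \<le> t\<close>, in which case the natural number subtraction below does not truncate.
\<close>

primrec Q_proj ::
    "real \<Rightarrow> real \<Rightarrow> (real \<Rightarrow> real) set \<Rightarrow> nat \<Rightarrow> nat \<Rightarrow> (real \<Rightarrow> real) \<Rightarrow> (real \<Rightarrow> real)" where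
  "Q_proj a b Z0 0 t u = Z_proj a b Z0 t u"
| "Q_proj a b Z0 (Suc q) t u =
     (\<lambda>x. point_value a b u a + K_op a (Q_proj a b Z0 q (t - 1) (weak_deriv a b 1 u)) x)"

end

theory Submission imports Defs begin

text \<open>
  Iterating \<open>u = u(a) + K \<partial>u\<close> and the recursion for \<open>Q\<^sub>t\<^sup>q\<close> gives
  \<open>u - Q\<^sub>t\<^sup>q u = K\<^sup>q e\<close> with \<open>e = (I - Z) \<partial>\<^sup>q u\<close> and \<open>Z = Z\<^bsub>t-q\<^esub>\<close>, hence
  \<open>\<partial>\<^sup>\<ell>(u - Q\<^sub>t\<^sup>q u) = K\<^bsup>q-\<ell>\<^esup> e\<close>. By Taylor's formula \<open>\<partial>\<^sup>q u\<close> and \<open>K\<^bsup>r-q\<^esup> \<partial>\<^sup>r u\<close> differ by a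
  polynomial of degree below \<open>r - q\<close>, so \<open>e = (I - Z) K\<^bsup>r-q\<^esup> \<partial>\<^sup>r u\<close>. Finally \<open>e\<close> is orthogonal to
  the range of \<open>Z\<close>, and \<open>(K\<^sup>s e, g) = (-1)\<^sup>s (e, K\<^sup>s g)\<close> whenever \<open>e\<close> is orthogonal to
  polynomials of degree below \<open>s\<close>; with \<open>g = K\<^sup>s e\<close> this yields
  \<open>\<parallel>K\<^sup>s e\<parallel> \<le> \<parallel>(I - Z) K\<^sup>s\<parallel> \<parallel>e\<parallel>\<close>.
\<close>

section \<open>The space of square integrable functions\<close>

text \<open>The difficulty lies less in the estimate than in making its terms meaningful for almost
  everywhere classes. \<open>weak_deriv\<close> is a choice, so its value must be pinned down up to
  null sets, which is the fundamental lemma of the calculus of variations; the formula u = u(a) + K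
  u' rests on the du Bois-Reymond lemma. Both need a rich supply of test functions, built here from
  exp(-1/x). The recursion for the projectors differentiates one order at a time, while the estimate
  speaks of derivatives of order r and l taken at once; iterated first derivatives link the two. The
  two polynomial inclusions serve different ends: the one with r - q absorbs the Taylor polynomial,
  the one with q - l absorbs the boundary terms that appear when the adjoint of K is traded for
  -K.\<close>

lemma finite_measure_interval: "finite_measure (lebesgue_on {a<..<b::real})"
  by (rule finite_measure_lebesgue_on) simp

lemma borel_measurable_on_interval:
  "f \<in> borel_measurable borel \<Longrightarrow> f \<in> borel_measurable (lebesgue_on {a<..<b::real})"
  by (simp add: measurable_completion measurable_restrict_space1)

lemma integrable_const_interval: "integrable (lebesgue_on {a<..<b::real}) (\<lambda>_. c::real)"
  using finite_measure_interval by (rule finite_measure.integrable_const)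

lemma L2_measurable: "f \<in> L2 a b \<Longrightarrow> f \<in> borel_measurable (lebesgue_on {a<..<b})"
  by (simp add: L2_def)

lemma L2_mult_integrable:
  assumes "f \<in> L2 a b" "g \<in> L2 a b"
  shows "integrable (lebesgue_on {a<..<b}) (\<lambda>x. f x * g x)"
proof (rule Bochner_Integration.integrable_bound)
  show "integrable (lebesgue_on {a<..<b}) (\<lambda>x. (f x)\<^sup>2 + (g x)\<^sup>2)"
    using assms by (simp add: L2_def)
  show "(\<lambda>x. f x * g x) \<in> borel_measurable (lebesgue_on {a<..<b})"
    using assms by (intro borel_measurable_times) (simp_all add: L2_def)
  have "\<bar>f x * g x\<bar> \<le> (f x)\<^sup>2 + (g x)\<^sup>2" for x
  proof -
    have "0 \<le> (\<bar>f x\<bar> - \<bar>g x\<bar>)\<^sup>2" "0 \<le> \<bar>f x\<bar> * \<bar>g x\<bar>" by simp_all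
    then show ?thesis unfolding power2_diff abs_mult power2_abs by linarith
  qed
  then show "AE x in lebesgue_on {a<..<b}. norm (f x * g x) \<le> norm ((f x)\<^sup>2 + (g x)\<^sup>2)"
    by (intro AE_I2) simp
qed

lemma L2_bounded:
  assumes "f \<in> borel_measurable (lebesgue_on {a<..<b})" "\<And>x. a < x \<Longrightarrow> x < b \<Longrightarrow> \<bar>f x\<bar> \<le> B"
  shows "f \<in> L2 a b"
proof -
  have "integrable (lebesgue_on {a<..<b}) (\<lambda>x. (f x)\<^sup>2)"
  proof (rule Bochner_Integration.integrable_bound)
    show "integrable (lebesgue_on {a<..<b}) (\<lambda>x. B\<^sup>2)" by (rule integrable_const_interval)
    show "(\<lambda>x. (f x)\<^sup>2) \<in> borel_measurable (lebesgue_on {a<..<b})"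
      using assms(1) by (rule borel_measurable_power)
    show "AE x in lebesgue_on {a<..<b}. norm ((f x)\<^sup>2) \<le> norm (B\<^sup>2)"
      using assms(2) by (intro AE_I2) (auto simp: abs_le_square_iff[symmetric] intro: order_trans[OF _ abs_ge_self])
  qed
  then show ?thesis using assms(1) by (simp add: L2_def)
qed

lemma L2_const: "(\<lambda>_. c) \<in> L2 a b"
  by (rule L2_bounded[where B = "\<bar>c\<bar>"]) auto

lemma L2_add:
  assumes "f \<in> L2 a b" "g \<in> L2 a b"
  shows "(\<lambda>x. f x + g x) \<in> L2 a b"
proof -
  have "integrable (lebesgue_on {a<..<b}) (\<lambda>x. (f x)\<^sup>2 + (g x)\<^sup>2 + 2 * (f x * g x))"
    using assms L2_mult_integrable[OF assms] by (simp add: L2_def)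
  moreover have "(\<lambda>x. (f x)\<^sup>2 + (g x)\<^sup>2 + 2 * (f x * g x)) = (\<lambda>x. (f x + g x)\<^sup>2)"
    by (auto simp: power2_sum)
  ultimately show ?thesis using assms by (auto simp: L2_def intro: borel_measurable_add)
qed

lemma L2_scale: "f \<in> L2 a b \<Longrightarrow> (\<lambda>x. c * f x) \<in> L2 a b"
  by (auto simp: L2_def power_mult_distrib intro: borel_measurable_times)

lemma L2_diff:
  assumes "f \<in> L2 a b" "g \<in> L2 a b"
  shows "(\<lambda>x. f x - g x) \<in> L2 a b"
  using L2_add[OF assms(1) L2_scale[OF assms(2), of "-1"]] by simp

lemma L2_finite_sum:
  "(\<And>i. i \<in> I \<Longrightarrow> f i \<in> L2 a b) \<Longrightarrow> (\<lambda>x. \<Sum>i\<in>I. f i x) \<in> L2 a b"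
  by (induction I rule: infinite_finite_induct) (auto simp: L2_const intro: L2_add)

lemma L2_continuous:
  assumes "continuous_on {a..b} f"
  shows "f \<in> L2 a b"
proof -
  have "bounded (f ` {a..b})"
    using assms by (intro compact_imp_bounded compact_continuous_image) auto
  then obtain B where "\<And>x. x \<in> {a..b} \<Longrightarrow> \<bar>f x\<bar> \<le> B"
    unfolding bounded_iff by (metis image_eqI real_norm_def)
  moreover have "f \<in> borel_measurable (lebesgue_on {a<..<b})"
    using assms by (intro continuous_imp_measurable_on_sets_lebesgue) (auto intro: continuous_on_subset)
  ultimately show ?thesis by (intro L2_bounded[where B = B]) auto
qed

lemma L2_integrable: "f \<in> L2 a b \<Longrightarrow> integrable (lebesgue_on {a<..<b}) f"
  using L2_mult_integrable[OF _ L2_const[of 1]] by force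

lemma L2_inner_commute: "L2_inner a b f g = L2_inner a b g f"
  by (simp add: L2_inner_def mult.commute)

lemma L2_inner_add_left:
  assumes "f \<in> L2 a b" "g \<in> L2 a b" "h \<in> L2 a b"
  shows "L2_inner a b (\<lambda>x. f x + g x) h = L2_inner a b f h + L2_inner a b g h"
  by (simp add: L2_inner_def distrib_right Bochner_Integration.integral_add L2_mult_integrable assms)

lemma L2_inner_scale_left: "L2_inner a b (\<lambda>x. c * f x) g = c * L2_inner a b f g"
  by (simp add: L2_inner_def mult.assoc)

lemma L2_inner_diff_left:
  assumes "f \<in> L2 a b" "g \<in> L2 a b" "h \<in> L2 a b"
  shows "L2_inner a b (\<lambda>x. f x - g x) h = L2_inner a b f h - L2_inner a b g h"
  by (simp add: L2_inner_def left_diff_distrib Bochner_Integration.integral_diff L2_mult_integrable assms)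

lemma L2_inner_add_right:
  assumes "f \<in> L2 a b" "g \<in> L2 a b" "h \<in> L2 a b"
  shows "L2_inner a b h (\<lambda>x. f x + g x) = L2_inner a b h f + L2_inner a b h g"
  using L2_inner_add_left[OF assms] by (simp add: L2_inner_commute)

lemma L2_inner_scale_right: "L2_inner a b g (\<lambda>x. c * f x) = c * L2_inner a b g f"
  using L2_inner_scale_left by (metis L2_inner_commute)

lemma L2_inner_diff_right:
  assumes "f \<in> L2 a b" "g \<in> L2 a b" "h \<in> L2 a b"
  shows "L2_inner a b h (\<lambda>x. f x - g x) = L2_inner a b h f - L2_inner a b h g"
  using L2_inner_diff_left[OF assms] by (simp add: L2_inner_commute)

lemma L2_inner_self_nonneg: "0 \<le> L2_inner a b f f"
  by (simp add: L2_inner_def)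

lemma L2_norm_nonneg: "0 \<le> L2_norm a b f"
  by (simp add: L2_norm_def L2_inner_self_nonneg)

lemma L2_norm_power2: "(L2_norm a b f)\<^sup>2 = L2_inner a b f f"
  by (simp add: L2_norm_def L2_inner_self_nonneg)

lemma L2_norm_scale: "L2_norm a b (\<lambda>x. c * f x) = \<bar>c\<bar> * L2_norm a b f"
  by (simp add: L2_norm_def L2_inner_scale_left L2_inner_scale_right real_sqrt_mult
      flip: mult.assoc)

lemma L2_norm_eq_0_iff:
  assumes "f \<in> L2 a b"
  shows "L2_norm a b f = 0 \<longleftrightarrow> L2_eq a b f (\<lambda>_. 0)"
  using integral_nonneg_eq_0_iff_AE[OF L2_mult_integrable[OF assms assms]]
  by (simp add: L2_norm_def L2_inner_def L2_eq_def)

text \<open>The quadratic form (s, t) -> |s f - t g|^2 is nonnegative. Keeping both parameters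
  avoids dividing by (f, f).\<close>

lemma Cauchy_Schwarz_L2:
  assumes f: "f \<in> L2 a b" and g: "g \<in> L2 a b"
  shows "\<bar>L2_inner a b f g\<bar> \<le> L2_norm a b f * L2_norm a b g"
proof -
  let ?A = "L2_inner a b f f" and ?B = "L2_inner a b f g" and ?C = "L2_inner a b g g"
  have quad: "0 \<le> ?A * s\<^sup>2 - 2 * s * t * ?B + ?C * t\<^sup>2" for s t
  proof -
    have "L2_inner a b (\<lambda>x. s * f x - t * g x) (\<lambda>x. s * f x - t * g x)
        = ?A * s\<^sup>2 - 2 * s * t * ?B + ?C * t\<^sup>2"
      using f g
      by (simp add: L2_inner_diff_left L2_inner_diff_right L2_inner_scale_left L2_inner_scale_right
          L2_scale L2_diff L2_inner_commute[of a b g f] power2_eq_square algebra_simps)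
    then show ?thesis using L2_inner_self_nonneg by metis
  qed
  have "?B\<^sup>2 \<le> ?A * ?C"
  proof (cases "?A = 0")
    case True
    have "?B = 0"
    proof (rule ccontr)
      assume "?B \<noteq> 0"
      \<comment> \<open>With (f, f) = 0 the form is linear in s; this s makes it equal to
        -1.\<close>
      with quad[of "(?C + 1) / (2 * ?B)" 1] True show False by (simp add: field_simps)
    qed
    then show ?thesis using L2_inner_self_nonneg by simp
  next
    case False
    then have "0 < ?A" using L2_inner_self_nonneg[of a b f] by simp
    have "0 \<le> ?A * (?A * ?C - ?B\<^sup>2)"
      \<comment> \<open>At s = (f, g), t = (f, f) the form factors as displayed.\<close>
      using quad[of "?B" "?A"] by (simp add: power2_eq_square algebra_simps)
    with \<open>0 < ?A\<close> show ?thesis by (simp add: zero_le_mult_iff)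
  qed
  then have "sqrt (?B\<^sup>2) \<le> sqrt (?A * ?C)" by (rule real_sqrt_le_mono)
  then show ?thesis by (simp add: L2_norm_def real_sqrt_mult)
qed

lemma L2_eq_refl [simp]: "L2_eq a b f f"
  by (simp add: L2_eq_def)

lemma L2_eq_sym: "L2_eq a b f g \<Longrightarrow> L2_eq a b g f"
  by (simp add: L2_eq_def eq_commute)

lemma L2_eq_trans [trans]: "L2_eq a b f g \<Longrightarrow> L2_eq a b g h \<Longrightarrow> L2_eq a b f h"
  unfolding L2_eq_def by (erule (1) eventually_elim2) simp

lemma L2_eqI: "(\<And>x. a < x \<Longrightarrow> x < b \<Longrightarrow> f x = g x) \<Longrightarrow> L2_eq a b f g"
  unfolding L2_eq_def by (rule AE_I2) simp

lemma L2_eq_add: "L2_eq a b f g \<Longrightarrow> L2_eq a b h k \<Longrightarrow> L2_eq a b (\<lambda>x. f x + h x) (\<lambda>x. g x + k x)"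
  unfolding L2_eq_def by (erule (1) eventually_elim2) simp

lemma L2_eq_diff: "L2_eq a b f g \<Longrightarrow> L2_eq a b h k \<Longrightarrow> L2_eq a b (\<lambda>x. f x - h x) (\<lambda>x. g x - k x)"
  unfolding L2_eq_def by (erule (1) eventually_elim2) simp

lemma L2_eq_scale: "L2_eq a b f g \<Longrightarrow> L2_eq a b (\<lambda>x. c * f x) (\<lambda>x. c * g x)"
  unfolding L2_eq_def by (erule eventually_mono) simp

lemma L2_inner_cong:
  assumes "f \<in> L2 a b" "f' \<in> L2 a b" "g \<in> L2 a b" "g' \<in> L2 a b" "L2_eq a b f f'" "L2_eq a b g g'"
  shows "L2_inner a b f g = L2_inner a b f' g'"
  unfolding L2_inner_def
proof (rule integral_cong_AE)
  show "AE x in lebesgue_on {a<..<b}. f x * g x = f' x * g' x"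
    using assms(5,6) unfolding L2_eq_def by eventually_elim simp
qed (use assms(1-4) in \<open>auto simp: L2_def\<close>)

lemma L2_norm_cong:
  "f \<in> L2 a b \<Longrightarrow> g \<in> L2 a b \<Longrightarrow> L2_eq a b f g \<Longrightarrow> L2_norm a b f = L2_norm a b g"
  unfolding L2_norm_def by (intro arg_cong[where f = sqrt] L2_inner_cong)

section \<open>The integration operator\<close>

lemma L2_indicator: "S \<in> sets borel \<Longrightarrow> indicator S \<in> L2 a b"
  by (rule L2_bounded[where B = 1]) (auto intro!: borel_measurable_on_interval simp: indicator_def)

text \<open>Point values of K f as inner products: linearity, independence of the representative and
  continuity of K f all reduce to facts about \<open>L2_inner\<close>.\<close>

lemma K_op_eq_inner:
  assumes "a < b" "f \<in> L2 a b" "a \<le> x" "x \<le> b"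
  shows "K_op a f x = L2_inner a b f (indicator {..x})"
proof -
  let ?g = "\<lambda>y. indicator {a<..<b} y *\<^sub>R (f y * indicator {..x} y)"
  \<comment> \<open>\<open>K_op\<close> integrates over a closed interval and the inner product over
    the open one; \<open>?c\<close> is the discrepancy at the end points, with integral
    zero.\<close>
  let ?c = "\<lambda>y. f a * indicator {a} y + (if x = b then f b else 0) * indicator {b} y"
  have "integrable (lebesgue_on {a<..<b}) (\<lambda>y. f y * indicator {..x} y)"
    using assms by (intro L2_mult_integrable L2_indicator) auto
  then have int: "integrable lebesgue ?g"
    by (simp add: integrable_restrict_space)
  have sing: "integrable lebesgue (indicator {z} :: real \<Rightarrow> real)"
      "(\<integral>y. (indicator {z} y :: real) \<partial>lebesgue) = 0" for z :: real
    by simp_all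
  have "K_op a f x = (\<integral>y. ?g y + ?c y \<partial>lebesgue)"
    unfolding K_op_def set_lebesgue_integral_def using assms
    by (intro Bochner_Integration.integral_cong) (auto simp: indicator_def)
  also have "\<dots> = (\<integral>y. ?g y \<partial>lebesgue) + (\<integral>y. ?c y \<partial>lebesgue)"
    using int sing by (intro Bochner_Integration.integral_add Bochner_Integration.integrable_add integrable_mult_right) auto
  also have "(\<integral>y. ?c y \<partial>lebesgue) = f a * (\<integral>y. (indicator {a} y :: real) \<partial>lebesgue) 
      + (if x = b then f b else 0) * (\<integral>y. (indicator {b} y :: real) \<partial>lebesgue)"
    using sing by (subst Bochner_Integration.integral_add) (auto intro: integrable_mult_right)
  also have "\<dots> = 0" using sing by simp
  finally show ?thesis
    by (simp add: L2_inner_def integral_restrict_space)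
qed

lemma L2_eq_singleton: "f = (\<lambda>x. if x = c then d else g x) \<Longrightarrow> L2_eq a b f g"
proof -
  assume f: "f = (\<lambda>x. if x = c then d else g x)"
  have "AE x in lebesgue_on {a<..<b}. x \<notin> {c} \<inter> {a<..<b}"
    by (rule AE_not_in) (auto simp: null_sets_restrict_space negligible_Int simp flip: negligible_iff_null_sets)
  moreover have "AE x in lebesgue_on {a<..<b}. x \<in> {a<..<b}" by (rule AE_I2) simp
  ultimately show ?thesis unfolding L2_eq_def by eventually_elim (auto simp: f)
qed

lemma L2_norm_indicator_le:
  assumes "x \<le> y"
  shows "L2_norm a b (indicator {x<..y}) \<le> sqrt (y - x)"
proof -
  have "L2_inner a b (indicator {x<..y}) (indicator {x<..y}) 
      = (LINT z|lebesgue_on {a<..<b}. indicator {x<..y} z)"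
    unfolding L2_inner_def by (intro Bochner_Integration.integral_cong) (auto simp: indicator_def)
  also have "\<dots> = (\<integral>z. indicator {a<..<b} z * indicator {x<..y} z \<partial>lebesgue)"
    by (subst integral_restrict_space) simp_all
  also have "\<dots> = (\<integral>z. indicator ({a<..<b} \<inter> {x<..y}) z \<partial>lebesgue)"
    by (simp only: indicator_inter_arith)
  also have "\<dots> = measure lebesgue ({a<..<b} \<inter> {x<..y})" by simp
  also have "\<dots> \<le> measure lebesgue {x..y}"
    by (rule measure_mono_fmeasurable) auto
  also have "\<dots> = y - x" using assms by simp
  finally show ?thesis unfolding L2_norm_def by simp
qed

text \<open>Cauchy-Schwarz against the indicator of (x, y]. This is Hoelder continuity of exponent
  1/2, so K f is its own continuous representative.\<close>

lemma K_op_diff_le: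
  assumes "a < b" "f \<in> L2 a b" "a \<le> x" "x \<le> y" "y \<le> b"
  shows "\<bar>K_op a f y - K_op a f x\<bar> \<le> L2_norm a b f * sqrt (y - x)"
proof -
  have "K_op a f y - K_op a f x = L2_inner a b f (\<lambda>z. indicator {..y} z - indicator {..x} z)"
    using assms by (simp add: K_op_eq_inner L2_inner_diff_right L2_indicator)
  also have "(\<lambda>z. indicator {..y} z - indicator {..x} z) = (indicator {x<..y} :: real \<Rightarrow> real)"
    using assms by (auto simp: indicator_def)
  finally have "\<bar>K_op a f y - K_op a f x\<bar> \<le> L2_norm a b f * L2_norm a b (indicator {x<..y})"
    using assms by (simp add: Cauchy_Schwarz_L2 L2_indicator)
  also have "\<dots> \<le> L2_norm a b f * sqrt (y - x)"
    using assms by (intro mult_left_mono L2_norm_indicator_le L2_norm_nonneg) auto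
  finally show ?thesis .
qed

lemma continuous_on_K_op:
  assumes "a < b" "f \<in> L2 a b"
  shows "continuous_on {a..b} (K_op a f)"
  unfolding continuous_on_def
proof
  fix x assume x: "x \<in> {a..b}"
  have bound: "\<bar>K_op a f y - K_op a f x\<bar> \<le> L2_norm a b f * sqrt \<bar>y - x\<bar>" if "y \<in> {a..b}" for y
  proof (cases "x \<le> y")
    case True
    then show ?thesis using K_op_diff_le[OF assms, of x y] x that by simp
  next
    case False
    then show ?thesis using K_op_diff_le[OF assms, of y x] x that by (simp add: abs_minus_commute)
  qed
  have "((\<lambda>y. L2_norm a b f * sqrt \<bar>y - x\<bar>) \<longlongrightarrow> L2_norm a b f * sqrt \<bar>x - x\<bar>) (at x within {a..b})"
    by (intro tendsto_intros)
  then have lim: "((\<lambda>y. L2_norm a b f * sqrt \<bar>y - x\<bar>) \<longlongrightarrow> 0) (at x within {a..b})" by simp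
  have "((\<lambda>y. K_op a f y - K_op a f x) \<longlongrightarrow> 0) (at x within {a..b})"
    by (rule Lim_null_comparison[OF _ lim]) (auto simp: eventually_at_filter bound)
  then show "(K_op a f \<longlongrightarrow> K_op a f x) (at x within {a..b})" by (simp add: LIM_zero_iff)
qed

lemma K_op_L2: "a < b \<Longrightarrow> f \<in> L2 a b \<Longrightarrow> K_op a f \<in> L2 a b"
  by (blast intro: L2_continuous continuous_on_K_op)

lemma K_op_funpow_L2: "a < b \<Longrightarrow> f \<in> L2 a b \<Longrightarrow> (K_op a ^^ s) f \<in> L2 a b"
  by (induction s) (auto intro: K_op_L2)

lemma K_op_start [simp]: "K_op a f a = 0"
proof -
  have "(LINT y|lebesgue. indicator {a} y * f y) = (LINT y|lebesgue. f a * indicator {a} y)"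
    by (intro Bochner_Integration.integral_cong) (auto simp: indicator_def)
  also have "\<dots> = 0" by (subst integral_mult_right_zero) simp
  finally show ?thesis by (simp add: K_op_def set_lebesgue_integral_def)
qed

lemma K_op_cong:
  assumes "a < b" "f \<in> L2 a b" "g \<in> L2 a b" "L2_eq a b f g" "a \<le> x" "x \<le> b"
  shows "K_op a f x = K_op a g x"
  using assms by (simp add: K_op_eq_inner) (intro L2_inner_cong L2_indicator; simp)

lemma K_op_add:
  assumes "a < b" "f \<in> L2 a b" "g \<in> L2 a b" "a \<le> x" "x \<le> b"
  shows "K_op a (\<lambda>y. f y + g y) x = K_op a f x + K_op a g x"
  using assms by (simp add: K_op_eq_inner L2_add L2_inner_add_left L2_indicator)

lemma K_op_scale:
  assumes "a < b" "f \<in> L2 a b" "a \<le> x" "x \<le> b"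
  shows "K_op a (\<lambda>y. c * f y) x = c * K_op a f x"
  using assms by (simp add: K_op_eq_inner L2_scale L2_inner_scale_left)

lemma K_op_diff:
  assumes "a < b" "f \<in> L2 a b" "g \<in> L2 a b" "a \<le> x" "x \<le> b"
  shows "K_op a (\<lambda>y. f y - g y) x = K_op a f x - K_op a g x"
  using assms by (simp add: K_op_eq_inner L2_diff L2_inner_diff_left L2_indicator)

lemma K_op_sum:
  assumes "a < b" "a \<le> x" "x \<le> b" "\<And>i. i \<in> I \<Longrightarrow> f i \<in> L2 a b"
  shows "K_op a (\<lambda>y. \<Sum>i\<in>I. f i y) x = (\<Sum>i\<in>I. K_op a (f i) x)"
  using assms(4)
proof (induction I rule: infinite_finite_induct)
  case (insert i I)
  then show ?case using assms(1-3) by (simp add: K_op_add L2_finite_sum)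
qed (simp_all add: K_op_def set_lebesgue_integral_def)

lemma K_op_funpow_scale:
  assumes "a < b" "f \<in> L2 a b"
  shows "L2_eq a b ((K_op a ^^ s) (\<lambda>y. c * f y)) (\<lambda>x. c * (K_op a ^^ s) f x)"
proof (induction s)
  case (Suc s)
  have "L2_eq a b (K_op a ((K_op a ^^ s) (\<lambda>y. c * f y))) (K_op a (\<lambda>x. c * (K_op a ^^ s) f x))"
    by (intro L2_eqI K_op_cong[OF assms(1) K_op_funpow_L2[OF assms(1) L2_scale[OF assms(2)]]
          L2_scale[OF K_op_funpow_L2[OF assms]] Suc]) auto
  also have "L2_eq a b \<dots> (\<lambda>x. c * K_op a ((K_op a ^^ s) f) x)"
    using assms by (intro L2_eqI K_op_scale[where b = b]) (auto intro: K_op_funpow_L2)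
  finally show ?case by simp
qed simp

text \<open>Boundedness of K makes the supremum in \<open>L2_opnorm\<close> one over a bounded set.
  One factor sqrt(b - a) comes from the pointwise bound, the other from integrating its
  square.\<close>

lemma L2_norm_K_op_le:
  assumes "a < b" "f \<in> L2 a b"
  shows "L2_norm a b (K_op a f) \<le> (b - a) * L2_norm a b f"
proof -
  let ?B = "L2_norm a b f * sqrt (b - a)"
  have bound: "\<bar>K_op a f x\<bar> \<le> ?B" if "a < x" "x < b" for x
  proof -
    have "\<bar>K_op a f x\<bar> \<le> L2_norm a b f * sqrt (x - a)"
      using K_op_diff_le[OF assms, of a x] assms that by simp
    also have "\<dots> \<le> ?B" using that by (intro mult_left_mono L2_norm_nonneg) auto
    finally show ?thesis .
  qed
  have "L2_inner a b (K_op a f) (K_op a f) \<le> (LINT x|lebesgue_on {a<..<b}. ?B\<^sup>2)"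
    unfolding L2_inner_def
  proof (rule integral_mono)
    fix x assume "x \<in> space (lebesgue_on {a<..<b})"
    then have "\<bar>K_op a f x\<bar>\<^sup>2 \<le> ?B\<^sup>2" by (intro power_mono bound) auto
    then show "K_op a f x * K_op a f x \<le> ?B\<^sup>2" by (simp add: power2_eq_square)
  qed (use assms in \<open>auto intro: L2_mult_integrable K_op_L2 integrable_const_interval\<close>)
  also have "\<dots> = ?B\<^sup>2 * (b - a)"
    using assms by (simp add: measure_restrict_space)
  also have "\<dots> = ((b - a) * L2_norm a b f)\<^sup>2"
    using assms by (simp add: power_mult_distrib) (simp add: power2_eq_square)
  finally have "(L2_norm a b (K_op a f))\<^sup>2 \<le> ((b - a) * L2_norm a b f)\<^sup>2"
    by (simp add: L2_norm_power2)
  then show ?thesis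
    by (rule power2_le_imp_le) (use assms in \<open>simp add: L2_norm_nonneg\<close>)
qed

lemma L2_norm_K_op_funpow_le:
  assumes "a < b" "f \<in> L2 a b"
  shows "L2_norm a b ((K_op a ^^ s) f) \<le> (b - a) ^ s * L2_norm a b f"
proof (induction s)
  case (Suc s)
  have "L2_norm a b ((K_op a ^^ Suc s) f) \<le> (b - a) * L2_norm a b ((K_op a ^^ s) f)"
    using assms by (simp add: L2_norm_K_op_le K_op_funpow_L2)
  also have "\<dots> \<le> (b - a) * ((b - a) ^ s * L2_norm a b f)"
    using assms Suc by (intro mult_left_mono) auto
  finally show ?case by simp
qed simp

text \<open>Fubini on the triangle y \<le> x: after exchanging the integrals, g is integrated from y
  to b, which is its full integral minus K g(y).\<close>

lemma K_op_inner:
  assumes "a < b" "f \<in> L2 a b" "g \<in> L2 a b"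
  shows "L2_inner a b (K_op a f) g
       = L2_inner a b f (\<lambda>_. 1) * L2_inner a b g (\<lambda>_. 1) - L2_inner a b f (K_op a g)"
proof -
  let ?M = "lebesgue_on {a<..<b}"
  interpret M: finite_measure ?M by (rule finite_measure_interval)
  interpret P: pair_sigma_finite ?M ?M ..
  have id: "(\<lambda>x. x) \<in> borel_measurable ?M" by (rule borel_measurable_on_interval) simp
  have [measurable]: "f \<in> borel_measurable ?M" "g \<in> borel_measurable ?M"
    using assms by (auto simp: L2_def)
  define A where "A = {p \<in> space (?M \<Otimes>\<^sub>M ?M). snd p \<le> fst p}"
  have A: "A \<in> sets (?M \<Otimes>\<^sub>M ?M)"
    unfolding A_def
    by (intro borel_measurable_le measurable_compose[OF measurable_fst id]
        measurable_compose[OF measurable_snd id])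
  have fg: "integrable (?M \<Otimes>\<^sub>M ?M) (\<lambda>p. g (fst p) * f (snd p))"
  proof (rule P.Fubini_integrable)
    show "AE x in ?M. integrable ?M (\<lambda>y. g (fst (x, y)) * f (snd (x, y)))"
      using L2_integrable[OF assms(2)] by simp
    show "integrable ?M (\<lambda>x. LINT y|?M. norm (g (fst (x, y)) * f (snd (x, y))))"
      using L2_integrable[OF assms(2)] L2_integrable[OF assms(3)] by (simp add: abs_mult)
  qed measurable
  have int: "integrable (?M \<Otimes>\<^sub>M ?M) (\<lambda>(x, y). indicator A (x, y) * (g x * f y))"
    using integrable_mult_indicator[OF A fg] by (simp add: case_prod_beta')
  have K: "L2_inner a b h (indicator {..x}) = K_op a h x" if "h \<in> L2 a b" "a < x" "x < b" for h x
    using K_op_eq_inner[OF assms(1) that(1), of x] that by simp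
  have "L2_inner a b (K_op a f) g = (LINT x|?M. LINT y|?M. indicator A (x, y) * (g x * f y))"
    unfolding L2_inner_def
  proof (intro Bochner_Integration.integral_cong refl)
    fix x assume x: "x \<in> space ?M"
    have "(LINT y|?M. indicator A (x, y) * (g x * f y)) = (LINT y|?M. g x * (f y * indicator {..x} y))"
      using x by (intro Bochner_Integration.integral_cong) (auto simp: A_def space_pair_measure indicator_def)
    also have "\<dots> = g x * K_op a f x"
      using K[OF assms(2), of x] x by (simp add: L2_inner_def)
    finally show "K_op a f x * g x = (LINT y|?M. indicator A (x, y) * (g x * f y))"
      by simp
  qed
  also have "\<dots> = (LINT y|?M. LINT x|?M. indicator A (x, y) * (g x * f y))"
    by (rule P.Fubini_integral[OF int, symmetric])
  also have "\<dots> = L2_inner a b f (\<lambda>y. L2_inner a b g (\<lambda>_. 1) - K_op a g y)"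
    unfolding L2_inner_def[of a b f]
  proof (intro Bochner_Integration.integral_cong refl)
    fix y assume y: "y \<in> space ?M"
    have "(LINT x|?M. indicator A (x, y) * (g x * f y)) = (LINT x|?M. f y * (g x * indicator {y..} x))"
      using y by (intro Bochner_Integration.integral_cong) (auto simp: A_def space_pair_measure indicator_def)
    also have "\<dots> = f y * L2_inner a b g (indicator {y..})" by (simp add: L2_inner_def)
    \<comment> \<open>The two functions differ only at the point y.\<close>
    also have "L2_inner a b g (indicator {y..}) = L2_inner a b g (\<lambda>x. 1 - indicator {..y} x)"
      using assms
      by (intro L2_inner_cong L2_indicator L2_diff L2_const L2_eq_refl L2_eq_singleton[of _ y 1])
        (auto simp: indicator_def)
    also have "\<dots> = L2_inner a b g (\<lambda>_. 1) - K_op a g y"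
      using assms y by (simp add: L2_inner_diff_right L2_const L2_indicator K)
    finally show "(LINT x|?M. indicator A (x, y) * (g x * f y))
        = f y * (L2_inner a b g (\<lambda>_. 1) - K_op a g y)" .
  qed
  also have "\<dots> = L2_inner a b g (\<lambda>_. 1) * L2_inner a b f (\<lambda>_. 1) - L2_inner a b f (K_op a g)"
    using assms L2_inner_scale_right[of a b f "L2_inner a b g (\<lambda>_. 1)" "\<lambda>_. 1"]
    by (simp add: L2_inner_diff_right L2_const K_op_L2)
  finally show ?thesis by (simp add: mult.commute)
qed

section \<open>Polynomials under the integration operator\<close>

lemma pderiv_surj:
  fixes p :: "real poly"
  obtains P where "pderiv P = p" "degree P \<le> Suc (degree p)"
proof -
  define P where "P = (\<Sum>i\<le>degree p. monom (coeff p i / real (Suc i)) (Suc i))"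
  have "pderiv P = (\<Sum>i\<le>degree p. monom (coeff p i) i)"
    unfolding P_def by (subst higher_pderiv_sum[of 1, simplified]) (auto simp: pderiv_monom simp del: of_nat_Suc)
  also have "\<dots> = p" by (rule poly_as_sum_of_monoms)
  finally have "pderiv P = p" .
  moreover have "degree P \<le> Suc (degree p)"
    unfolding P_def by (intro degree_sum_le order_trans[OF degree_monom_le]) auto
  ultimately show thesis by (rule that)
qed

lemma K_op_poly:
  fixes p :: "real poly"
  assumes "a \<le> x"
  shows "K_op a (poly (pderiv p)) x = poly p x - poly p a"
proof -
  have "(poly (pderiv p) has_integral poly p x - poly p a) {a..x}"
    by (rule fundamental_theorem_of_calculus[OF assms])
      (auto intro: DERIV_subset poly_DERIV simp flip: has_real_derivative_iff_has_vector_derivative)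
  moreover have "set_integrable lebesgue {a..x} (poly (pderiv p))"
    by (intro absolutely_integrable_continuous_real continuous_intros)
  ultimately show ?thesis
    unfolding K_op_def by (simp add: set_lebesgue_integral_eq_integral(2) integral_unique)
qed

lemma poly_L2: "poly p \<in> L2 a b"
  by (intro L2_continuous continuous_intros)

lemma poly_space_I:
  "f \<in> L2 a b \<Longrightarrow> L2_eq a b f (poly p) \<Longrightarrow> p = 0 \<or> int (degree p) \<le> k \<Longrightarrow> f \<in> poly_space a b k"
  unfolding poly_space_def L2_saturate_def by blast

lemma poly_space_E:
  assumes "f \<in> poly_space a b k"
  obtains p where "f \<in> L2 a b" "L2_eq a b f (poly p)" "p = 0 \<or> int (degree p) \<le> k"
  using assms unfolding poly_space_def L2_saturate_def by blast

lemma poly_space_K_op: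
  assumes "a < b" "f \<in> poly_space a b k"
  shows "K_op a f \<in> poly_space a b (k + 1)"
proof -
  from assms(2) obtain p where p: "f \<in> L2 a b" "L2_eq a b f (poly p)" "p = 0 \<or> int (degree p) \<le> k"
    by (rule poly_space_E)
  obtain P where P: "pderiv P = p" "degree P \<le> Suc (degree p)" by (rule pderiv_surj)
  have eq: "K_op a f x = poly (P - [:poly P a:]) x" if "a < x" "x < b" for x
    using K_op_cong[OF assms(1) p(1) poly_L2 p(2), of x] K_op_poly[of a x P] P that by simp
  show ?thesis
  proof (rule poly_space_I[where p = "P - [:poly P a:]"])
    show "K_op a f \<in> L2 a b" using assms(1) p(1) by (rule K_op_L2)
    show "L2_eq a b (K_op a f) (poly (P - [:poly P a:]))" by (intro L2_eqI eq)
    show "P - [:poly P a:] = 0 \<or> int (degree (P - [:poly P a:])) \<le> k + 1"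
    \<comment> \<open>For negative \<open>k\<close> a degree count is not enough: K f must vanish,
      and it does because the constant of integration P(a) is subtracted.\<close>
    proof (cases "p = 0")
      case True
      then obtain c where "P = [:c:]" using P(1) pderiv_iszero by blast
      then show ?thesis by simp
    next
      case False
      have "degree (P - [:poly P a:]) \<le> Suc (degree p)" using P(2) by (intro degree_diff_le) auto
      then show ?thesis using False p(3) by simp
    qed
  qed
qed

lemma poly_space_K_op_funpow: "a < b \<Longrightarrow> f \<in> poly_space a b k \<Longrightarrow> (K_op a ^^ s) f \<in> poly_space a b (k + int s)"
proof (induction s)
  case (Suc s)
  then show ?case using poly_space_K_op[of a b "(K_op a ^^ s) f" "k + int s"] by (simp add: algebra_simps)
qed simp

lemma poly_space_add:
  assumes "f \<in> poly_space a b k" "g \<in> poly_space a b k"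
  shows "(\<lambda>x. f x + g x) \<in> poly_space a b k"
proof -
  obtain p where p: "f \<in> L2 a b" "L2_eq a b f (poly p)" "p = 0 \<or> int (degree p) \<le> k"
    using assms(1) by (rule poly_space_E)
  obtain q where q: "g \<in> L2 a b" "L2_eq a b g (poly q)" "q = 0 \<or> int (degree q) \<le> k"
    using assms(2) by (rule poly_space_E)
  show ?thesis
  proof (rule poly_space_I)
    show "L2_eq a b (\<lambda>x. f x + g x) (poly (p + q))" 
      using L2_eq_add[OF p(2) q(2)] by (simp add: poly_add[abs_def])
    have "degree (p + q) \<le> max (degree p) (degree q)" by (rule degree_add_le_max)
    then show "p + q = 0 \<or> int (degree (p + q)) \<le> k" using p(3) q(3) by auto
  qed (use p q L2_add in auto)
qed

lemma poly_space_const: "0 \<le> k \<Longrightarrow> (\<lambda>_. c) \<in> poly_space a b k"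
  by (rule poly_space_I[where p = "[:c:]"]) (auto intro: L2_const L2_eqI)

lemma poly_space_mono: "j \<le> k \<Longrightarrow> poly_space a b j \<subseteq> poly_space a b k"
  by (auto elim!: poly_space_E intro: poly_space_I)

text \<open>Since \<open>K + K\<^sup>*\<close> is integration against the constant function 1, the powers of \<open>K\<close> are
  (skew-)symmetric modulo polynomials.\<close>

lemma K_op_funpow_inner:
  assumes ab: "a < b" and f: "f \<in> L2 a b" and g: "g \<in> L2 a b"
    and orth: "\<And>w. w \<in> poly_space a b (int s - 1) \<Longrightarrow> L2_inner a b f w = 0"
  shows "L2_inner a b ((K_op a ^^ s) f) g = (-1) ^ s * L2_inner a b f ((K_op a ^^ s) g)"
  using g orth
proof (induction s arbitrary: g)
  case (Suc s)
  have IH: "L2_inner a b ((K_op a ^^ s) f) h = (-1) ^ s * L2_inner a b f ((K_op a ^^ s) h)"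
    if "h \<in> L2 a b" for h
    using that by (rule Suc.IH) (use Suc.prems(2) poly_space_mono[of "int s - 1" "int (Suc s) - 1"] in auto)
  \<comment> \<open>The rank-one term of \<open>K_op_inner\<close> contains (K^s f, 1). The
    induction hypothesis turns it into (f, K^s 1) up to sign, and K^s 1 is a polynomial of degree at
    most s.\<close>
  have "(K_op a ^^ s) (\<lambda>_. 1) \<in> poly_space a b (int (Suc s) - 1)"
    using poly_space_K_op_funpow[OF ab poly_space_const[of 0], where s = s] by simp
  then have "L2_inner a b ((K_op a ^^ s) f) (\<lambda>_. 1) = 0"
    using Suc.prems(2) by (simp add: IH L2_const)
  then have "L2_inner a b ((K_op a ^^ Suc s) f) g = - L2_inner a b ((K_op a ^^ s) f) (K_op a g)"
    using ab f Suc.prems(1) by (simp add: K_op_inner K_op_funpow_L2)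
  also have "\<dots> = (-1) ^ Suc s * L2_inner a b f ((K_op a ^^ Suc s) g)"
    using ab Suc.prems(1) by (simp add: IH K_op_L2 funpow_swap1)
  finally show ?case .
qed simp

section \<open>Test functions and weak derivatives\<close>

text \<open>The flat function exp(-1/x) together with all polynomial multiples in 1/x: the
  derivative has the same form with another polynomial, so smoothness follows by induction.\<close>

definition bump_factor :: "real poly \<Rightarrow> real \<Rightarrow> real" where
  "bump_factor p x = (if 0 < x then poly p (1 / x) * exp (- (1 / x)) else 0)"

lemma poly_exp_tendsto_0: "((\<lambda>y::real. poly p y * exp (- y)) \<longlongrightarrow> 0) at_top"
proof -
  have "((\<lambda>y::real. \<Sum>i\<le>degree p. coeff p i * (y ^ i / exp y)) \<longlongrightarrow> (\<Sum>i\<le>degree p. coeff p i * 0)) at_top"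
    by (intro tendsto_intros tendsto_power_div_exp_0)
  then show ?thesis
    by (simp add: poly_altdef exp_minus divide_inverse sum_distrib_right mult.assoc)
qed

text \<open>In the variable y = 1/x the derivative is -y^2 d/dy, which explains the factor
  \<open>[:0, 0, 1:]\<close>.\<close>

lemma DERIV_bump_factor:
  "(bump_factor p has_field_derivative bump_factor ([:0, 0, 1:] * (p - pderiv p)) x) (at x)"
proof -
  consider "x > 0" | "x < 0" | "x = 0" by linarith
  then show ?thesis
  proof cases
    case 1
    have "((\<lambda>x. poly p (1 / x) * exp (- (1 / x))) has_field_derivative
        bump_factor ([:0, 0, 1:] * (p - pderiv p)) x) (at x)"
      using 1 by (auto intro!: derivative_eq_intros DERIV_chain2[OF poly_DERIV]
          simp: bump_factor_def power2_eq_square field_simps)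
    then show ?thesis
      by (rule has_field_derivative_transform_within_open[of _ _ _ "{0<..}"])
        (use 1 in \<open>auto simp: bump_factor_def\<close>)
  next
    case 2
    have "((\<lambda>x. 0) has_field_derivative bump_factor ([:0, 0, 1:] * (p - pderiv p)) x) (at x)"
      using 2 by (simp add: bump_factor_def)
    then show ?thesis
      by (rule has_field_derivative_transform_within_open[of _ _ _ "{..<0}"])
        (use 2 in \<open>auto simp: bump_factor_def\<close>)
  next
    case 3
    \<comment> \<open>The difference quotient at 0 carries an extra 1/h, absorbed by multiplying the
      polynomial by its variable.\<close>
    have "((\<lambda>h. poly (pCons 0 p) (inverse h) * exp (- inverse h)) \<longlongrightarrow> 0) (at_right (0::real))"
      by (rule filterlim_compose[OF poly_exp_tendsto_0 filterlim_inverse_at_top_right])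
    then have "((\<lambda>h. bump_factor p h / h) \<longlongrightarrow> 0) (at_right 0)"
      by (rule Lim_transform_eventually)
        (auto simp: eventually_at_filter bump_factor_def field_simps)
    moreover have "((\<lambda>h. bump_factor p h / h) \<longlongrightarrow> 0) (at_left 0)"
      by (rule Lim_transform_eventually[OF tendsto_const])
        (auto simp: eventually_at_filter bump_factor_def)
    ultimately have "((\<lambda>h. bump_factor p h / h) \<longlongrightarrow> 0) (at 0)"
      by (rule filterlim_split_at[rotated])
    then show ?thesis using 3 by (simp add: DERIV_def bump_factor_def)
  qed
qed

text \<open>Vanishes outside [c, d]; growing m steepens both flanks.\<close>

definition bump_product :: "real \<Rightarrow> real \<Rightarrow> real \<Rightarrow> real poly \<Rightarrow> real poly \<Rightarrow> real \<Rightarrow> real" where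
  "bump_product m c d p q x = bump_factor p (m * (x - c)) * bump_factor q (m * (d - x))"

text \<open>A linear span, so that the two terms of the product rule stay inside. The sign of m
  keeps one argument nonpositive outside [c, d], and the strict bounds on c and d keep the support
  inside the open interval.\<close>

inductive_set bump_space :: "real \<Rightarrow> real \<Rightarrow> (real \<Rightarrow> real) set" for a b where
  product: "a < c \<Longrightarrow> d < b \<Longrightarrow> 0 \<le> m \<Longrightarrow> bump_product m c d p q \<in> bump_space a b"
| add: "f \<in> bump_space a b \<Longrightarrow> g \<in> bump_space a b \<Longrightarrow> (\<lambda>x. f x + g x) \<in> bump_space a b"
| scale: "f \<in> bump_space a b \<Longrightarrow> (\<lambda>x. k * f x) \<in> bump_space a b"

lemma bump_space_DERIV:
  "f \<in> bump_space a b \<Longrightarrow> \<exists>g \<in> bump_space a b. \<forall>x. (f has_field_derivative g x) (at x)"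
proof (induction rule: bump_space.induct)
  case (product c d m p q)
  let ?p = "[:0, 0, 1:] * (p - pderiv p)" and ?q = "[:0, 0, 1:] * (q - pderiv q)"
  have 1: "((\<lambda>x. bump_factor p (m * (x - c))) has_field_derivative bump_factor ?p (m * (x - c)) * m) (at x)" for x
    by (rule DERIV_chain2[OF DERIV_bump_factor]) (auto intro!: derivative_eq_intros)
  have 2: "((\<lambda>x. bump_factor q (m * (d - x))) has_field_derivative bump_factor ?q (m * (d - x)) * (- m)) (at x)" for x
    by (rule DERIV_chain2[OF DERIV_bump_factor]) (auto intro!: derivative_eq_intros)
  have "(bump_product m c d p q has_field_derivative
      m * bump_product m c d ?p q x + (- m) * bump_product m c d p ?q x) (at x)" for x
    using DERIV_mult[OF 1 2, of x]
    unfolding bump_product_def by (simp only: algebra_simps)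
  moreover have "(\<lambda>x. m * bump_product m c d ?p q x + (- m) * bump_product m c d p ?q x) \<in> bump_space a b"
    by (intro bump_space.intros product)
  ultimately show ?case by (rule bexI[where P = "\<lambda>g. \<forall>x. _ g x", rotated, OF _ allI, rotated])
next
  case (add f g)
  then obtain f' g' where "f' \<in> bump_space a b" "g' \<in> bump_space a b"
    "\<And>x. (f has_field_derivative f' x) (at x)" "\<And>x. (g has_field_derivative g' x) (at x)" by blast
  then show ?case
    by (intro bexI[of _ "\<lambda>x. f' x + g' x"] allI DERIV_add bump_space.add)
next
  case (scale f k)
  then obtain f' where "f' \<in> bump_space a b" "\<And>x. (f has_field_derivative f' x) (at x)" by blast
  then show ?case
    by (intro bexI[of _ "\<lambda>x. k * f' x"] allI DERIV_cmult bump_space.scale)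
qed

lemma bump_space_higher_deriv:
  "f \<in> bump_space a b \<Longrightarrow> (deriv ^^ n) f \<in> bump_space a b"
proof (induction n)
  case (Suc n)
  then obtain g where g: "g \<in> bump_space a b" "\<And>x. ((deriv ^^ n) f has_field_derivative g x) (at x)"
    using bump_space_DERIV by blast
  then have "deriv ((deriv ^^ n) f) = g" by (auto intro!: DERIV_imp_deriv)
  then show ?case using g by simp
qed simp

lemma bump_space_differentiable:
  assumes "f \<in> bump_space a b"
  shows "(deriv ^^ n) f differentiable (at x)"
  using bump_space_DERIV[OF bump_space_higher_deriv[OF assms]] real_differentiable_def by blast

lemma bump_space_support:
  "f \<in> bump_space a b \<Longrightarrow> \<exists>c d. a < c \<and> d < b \<and> (\<forall>x. x \<notin> {c..d} \<longrightarrow> f x = 0)"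
proof (induction rule: bump_space.induct)
  case (product c d m p q)
  have "bump_product m c d p q x = 0" if "x \<notin> {c..d}" for x
  proof -
    have "m * (x - c) \<le> 0 \<or> m * (d - x) \<le> 0"
      using that product by (auto simp: mult_nonneg_nonpos)
    then show ?thesis by (auto simp: bump_product_def bump_factor_def)
  qed
  then show ?case using product by blast
next
  case (add f g)
  then obtain c d c' d' where cd: "a < c" "d < b" "a < c'" "d' < b"
      and f: "\<And>x. x \<notin> {c..d} \<Longrightarrow> f x = 0" and g: "\<And>x. x \<notin> {c'..d'} \<Longrightarrow> g x = 0"
    by metis
  have "f x + g x = 0" if "x \<notin> {min c c'..max d d'}" for x
  proof -
    have "x \<notin> {c..d}" "x \<notin> {c'..d'}"
      using that by (auto simp: min_le_iff_disj le_max_iff_disj)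
    then show ?thesis using f g by simp
  qed
  moreover have "a < min c c'" "max d d' < b" using cd by simp_all
  ultimately show ?case by blast
next
  case (scale f k)
  then show ?case by auto
qed

lemma test_funI:
  assumes "\<And>n x. (deriv ^^ n) f differentiable (at x)"
    and "a < c" "d < b" "\<And>x. x \<notin> {c..d} \<Longrightarrow> f x = 0"
  shows "test_fun a b f"
proof -
  have "closure {x. f x \<noteq> 0} \<subseteq> {c..d}"
    using assms(4) by (intro closure_minimal) (blast, simp)
  moreover have "compact (closure {x. f x \<noteq> 0})"
    using \<open>closure {x. f x \<noteq> 0} \<subseteq> {c..d}\<close> bounded_subset[OF bounded_closed_interval]
    by (meson closed_closure compact_eq_bounded_closed)
  ultimately show ?thesis using assms(1-3) by (fastforce simp: test_fun_def)
qed

lemma test_fun_bump_space: "f \<in> bump_space a b \<Longrightarrow> test_fun a b f"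
  using bump_space_support[of f a b] bump_space_differentiable[of f a b] test_funI by metis

section \<open>General test functions, integration by parts and primitives\<close>

lemma test_fun_support:
  assumes "a < b" "test_fun a b f"
  obtains c d where "a < c" "c \<le> d" "d < b" "\<And>x. x \<notin> {c..d} \<Longrightarrow> f x = 0"
proof -
  let ?S = "closure {x. f x \<noteq> 0}"
  \<comment> \<open>The midpoint makes the compact set nonempty when the test function is
    zero.\<close>
  let ?T = "insert ((a + b) / 2) ?S"
  have T: "compact ?T" "?T \<noteq> {}" "?T \<subseteq> {a<..<b}"
    using assms by (auto simp: test_fun_def field_simps)
  obtain c where c: "c \<in> ?T" "\<And>x. x \<in> ?T \<Longrightarrow> c \<le> x"
    using compact_attains_inf[OF T(1,2)] by blast
  obtain d where d: "d \<in> ?T" "\<And>x. x \<in> ?T \<Longrightarrow> x \<le> d"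
    using compact_attains_sup[OF T(1,2)] by blast
  show thesis
  proof (rule that)
    show "a < c" "d < b" "c \<le> d" using c d T(3) by auto
    fix x assume "x \<notin> {c..d}"
    then have "x \<notin> ?S" using c(2) d(2) by auto
    then show "f x = 0" using closure_subset[of "{x. f x \<noteq> 0}"] by auto
  qed
qed

lemma test_fun_outside: "a < b \<Longrightarrow> test_fun a b f \<Longrightarrow> x \<notin> {a<..<b} \<Longrightarrow> f x = 0"
  by (metis atLeastAtMost_iff greaterThanLessThan_iff order_less_le_trans order_le_less_trans test_fun_support)

lemma test_fun_DERIV: "test_fun a b f \<Longrightarrow> (f has_field_derivative deriv f x) (at x)"
  unfolding test_fun_def
  by (metis DERIV_deriv_iff_real_differentiable funpow_0)

lemma test_fun_deriv:
  assumes "test_fun a b f"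
  shows "test_fun a b (deriv f)"
proof -
  let ?S = "closure {x. f x \<noteq> 0}"
  have "deriv f x = 0" if "x \<notin> ?S" for x
  proof -
    have "((\<lambda>_. 0) has_field_derivative 0) (at x)" by simp
    then have "(f has_field_derivative 0) (at x)"
      by (rule has_field_derivative_transform_within_open[of _ _ _ "- ?S"])
        (use that closure_subset[of "{x. f x \<noteq> 0}"] in auto)
    then show ?thesis by (rule DERIV_imp_deriv)
  qed
  then have "{x. deriv f x \<noteq> 0} \<subseteq> ?S" by auto
  then have "closure {x. deriv f x \<noteq> 0} \<subseteq> ?S" by (simp add: closure_minimal)
  moreover have "(deriv ^^ n) (deriv f) differentiable (at x)" for n x
    using assms unfolding test_fun_def by (metis comp_apply funpow_Suc_right)
  ultimately show ?thesis using assms unfolding test_fun_def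
    by (meson closed_closure closed_subset compact_eq_bounded_closed bounded_subset order_trans)
qed

lemma test_fun_higher_deriv: "test_fun a b f \<Longrightarrow> test_fun a b ((deriv ^^ n) f)"
  by (induction n) (auto intro: test_fun_deriv)

lemma continuous_on_test_fun: "test_fun a b f \<Longrightarrow> continuous_on S f"
  by (meson DERIV_continuous_on has_field_derivative_at_within test_fun_DERIV)

lemma test_fun_L2: "test_fun a b f \<Longrightarrow> f \<in> L2 a b"
  by (blast intro: L2_continuous continuous_on_test_fun)

lemma K_op_eq_integral:
  assumes "continuous_on {a..x} f"
  shows "K_op a f x = integral {a..x} f"
  unfolding K_op_def
  by (intro set_lebesgue_integral_eq_integral(2) absolutely_integrable_continuous_real assms)

lemma K_op_deriv_test_fun:
  assumes "a < b" "test_fun a b f" "a \<le> x"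
  shows "K_op a (deriv f) x = f x"
proof -
  have "(deriv f has_integral f x - f a) {a..x}"
    using assms(3) test_fun_DERIV[OF assms(2)]
    by (intro fundamental_theorem_of_calculus)
      (auto intro: has_field_derivative_at_within simp flip: has_real_derivative_iff_has_vector_derivative)
  moreover have "f a = 0" using assms by (intro test_fun_outside) auto
  ultimately show ?thesis
    by (simp add: K_op_eq_integral integral_unique continuous_on_test_fun[OF test_fun_deriv[OF assms(2)]])
qed

lemma K_op_end: "a < b \<Longrightarrow> f \<in> L2 a b \<Longrightarrow> K_op a f b = L2_inner a b f (\<lambda>_. 1)"
  by (simp add: K_op_eq_inner) (intro L2_inner_cong L2_eqI L2_indicator L2_const; simp)

text \<open>Integration by parts: in \<open>K_op_inner\<close> with g = \<open>deriv \<phi>\<close>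
  the mean of g vanishes and K g = \<phi>. In other words, f is the weak derivative of K f.\<close>

lemma K_op_inner_deriv:
  assumes "a < b" "f \<in> L2 a b" "test_fun a b \<phi>"
  shows "L2_inner a b (K_op a f) (deriv \<phi>) = - L2_inner a b f \<phi>"
proof -
  have L2: "deriv \<phi> \<in> L2 a b" "\<phi> \<in> L2 a b"
    using assms(3) by (auto intro: test_fun_L2 test_fun_deriv)
  have "L2_inner a b (deriv \<phi>) (\<lambda>_. 1) = 0"
    using K_op_end[OF assms(1) L2(1)] K_op_deriv_test_fun[OF assms(1,3), of b]
      test_fun_outside[OF assms(1,3), of b] assms(1) by simp
  moreover have "L2_inner a b f (K_op a (deriv \<phi>)) = L2_inner a b f \<phi>"
    using assms L2
    by (intro L2_inner_cong L2_eq_refl K_op_L2 L2_eqI K_op_deriv_test_fun[where b = b]) auto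
  ultimately show ?thesis using K_op_inner[OF assms(1,2) L2(1)] by simp
qed

text \<open>The primitive starting at a vanishes left of the support in any case; mean zero makes it
  vanish to the right as well.\<close>

lemma test_fun_antiderivative:
  assumes "a < b" "test_fun a b \<psi>" "L2_inner a b \<psi> (\<lambda>_. 1) = 0"
  obtains \<phi> where "test_fun a b \<phi>" "deriv \<phi> = \<psi>"
proof -
  obtain c d where cd: "a < c" "c \<le> d" "d < b" and zero: "\<And>x. x \<notin> {c..d} \<Longrightarrow> \<psi> x = 0"
    using test_fun_support[OF assms(1,2)] by blast
  have int: "\<psi> integrable_on {x..y}" for x y
    by (intro integrable_continuous_real continuous_on_test_fun[OF assms(2)])
  define \<phi> where "\<phi> x = integral {a..x} \<psi>" for x
  have zero_left: "\<phi> x = 0" if "x < c" for x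
  proof -
    have "integral {a..x} \<psi> = integral {a..x} (\<lambda>_. 0)"
      using that by (intro Henstock_Kurzweil_Integration.integral_cong zero) auto
    then show ?thesis by (simp add: \<phi>_def)
  qed
  have \<phi>_d: "\<phi> x = \<phi> d" if "d \<le> x" for x
  proof -
    have "integral {d..x} \<psi> = integral {d..x} (\<lambda>_. 0)"
      by (rule integral_spike[of "{d}"]) (auto intro!: zero)
    then show ?thesis
      using Henstock_Kurzweil_Integration.integral_combine[OF _ that int, of a] cd by (simp add: \<phi>_def)
  qed
  have "\<phi> b = 0"
    using assms K_op_end[OF assms(1) test_fun_L2[OF assms(2)]]
      K_op_eq_integral[OF continuous_on_test_fun[OF assms(2)], of a b] by (simp add: \<phi>_def)
  then have zero_right: "\<phi> x = 0" if "d < x" for x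
    using \<phi>_d[of x] \<phi>_d[of b] that cd by simp
  have deriv: "(\<phi> has_field_derivative \<psi> x) (at x)" for x
  proof (cases "x < c")
    case True
    have "((\<lambda>_. 0) has_field_derivative \<psi> x) (at x)" using True zero by simp
    then show ?thesis
      by (rule has_field_derivative_transform_within_open[of _ _ _ "{..<c}"])
        (use True zero_left in auto)
  next
    case False
    \<comment> \<open>Now x exceeds a but may lie beyond b, so the open neighbourhood is chosen
      relative to x.\<close>
    then have x: "x \<in> {a<..<x + 1}" using cd by auto
    have "(\<phi> has_field_derivative \<psi> x) (at x within {a..x + 1})"
      unfolding \<phi>_def[abs_def]
      by (rule integral_has_real_derivative[OF continuous_on_test_fun[OF assms(2)]]) (use x in auto)
    then have "(\<phi> has_field_derivative \<psi> x) (at x within {a<..<x + 1})"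
      by (rule DERIV_subset) auto
    then show ?thesis using at_within_open[OF x open_greaterThanLessThan] by simp
  qed
  then have eq: "deriv \<phi> = \<psi>" by (auto intro!: DERIV_imp_deriv)
  have "(deriv ^^ n) \<phi> differentiable (at x)" for n x
  proof (cases n)
    case 0
    then show ?thesis using deriv[of x] real_differentiable_def by auto
  next
    case (Suc k)
    then have "(deriv ^^ n) \<phi> = (deriv ^^ k) \<psi>" by (simp add: funpow_swap1 eq)
    then show ?thesis using assms(2) by (simp add: test_fun_def)
  qed
  then have "test_fun a b \<phi>"
    by (rule test_funI[of _ _ c d]) (use cd zero_left zero_right in force)+
  then show thesis using eq by (rule that)
qed

section \<open>The fundamental lemma, uniqueness of weak derivatives and the du Bois-Reymond
  lemma\<close>

lemma bump_factor_1_tendsto: "(bump_factor 1 \<longlongrightarrow> 1) at_top"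
proof -
  have "((\<lambda>x::real. exp (- (1 / x))) \<longlongrightarrow> exp (- 0)) at_top"
    by (intro tendsto_exp tendsto_minus) (simp add: tendsto_inverse_0_at_top[OF filterlim_ident] divide_inverse)
  then have "((\<lambda>x::real. exp (- (1 / x))) \<longlongrightarrow> 1) at_top" by simp
  then show ?thesis
    by (rule Lim_transform_eventually)
      (auto simp: bump_factor_def intro: eventually_mono[OF eventually_gt_at_top[of 0]])
qed

lemma bump_factor_1_bounds: "0 \<le> bump_factor 1 x" "bump_factor 1 x \<le> 1"
  by (simp_all add: bump_factor_def)

text \<open>The products \<open>exp (-1 / (n (x - c\<^sub>n))) exp (-1 / (n (d\<^sub>n - x)))\<close> with \<open>c\<^sub>n\<close> and \<open>d\<^sub>n\<close> tending to
  \<open>c\<close> and \<open>d\<close> from inside converge boundedly to the indicator function of \<open>(c,d)\<close>.\<close>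

lemma bump_approximates_indicator:
  assumes "a \<le> c" "d \<le> b"
  obtains \<psi> where "\<And>n. \<psi> n \<in> bump_space a b"
    "\<And>f. f \<in> L2 a b \<Longrightarrow> (\<lambda>n. L2_inner a b f (\<psi> n)) \<longlonglongrightarrow> L2_inner a b f (indicator {c<..<d})"
proof -
  \<comment> \<open>The offset keeps the support strictly inside (a, b) even if c = a or d = b.
    Times the slope n it stays below 1, so a point at distance y inside (c, d) has argument at least
    n y - 1.\<close>
  define \<psi> where "\<psi> n = bump_product (real n) (c + 1 / (real n + 1)) (d - 1 / (real n + 1)) 1 1" for n :: nat
  have mem: "\<psi> n \<in> bump_space a b" for n
  proof -
    have "0 < 1 / (real n + 1)" by simp
    then show ?thesis unfolding \<psi>_def using assms by (intro bump_space.product) linarith+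
  qed
  have bounds: "0 \<le> \<psi> n x" "\<psi> n x \<le> 1" for n x
    unfolding \<psi>_def bump_product_def by (auto intro: mult_le_one simp: bump_factor_1_bounds)
  have lim1: "(\<lambda>n. bump_factor 1 (real n * (y - 1 / (real n + 1)))) \<longlonglongrightarrow> (if 0 < y then 1 else 0)" for y
  proof (cases "0 < y")
    case True
    have "filterlim (\<lambda>n. real n * y - 1) at_top sequentially"
      using True by real_asymp
    then have "filterlim (\<lambda>n. real n * (y - 1 / (real n + 1))) at_top sequentially"
      by (rule filterlim_at_top_mono) (auto simp: field_simps)
    from filterlim_compose[OF bump_factor_1_tendsto this] True show ?thesis by simp
  next
    case False
    have "y - 1 / (real n + 1) \<le> 0" for n
    proof -
      have "0 \<le> 1 / (real n + 1)" by simp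
      then show ?thesis using False by linarith
    qed
    then have "bump_factor 1 (real n * (y - 1 / (real n + 1))) = 0" for n
      by (simp add: bump_factor_def not_less mult_nonneg_nonpos)
    then show ?thesis using False by simp
  qed
  have lim: "(\<lambda>n. \<psi> n x) \<longlonglongrightarrow> indicator {c<..<d} x" for x
  proof -
    have "\<psi> n x = bump_factor 1 (real n * (x - c - 1 / (real n + 1)))
        * bump_factor 1 (real n * (d - x - 1 / (real n + 1)))" for n
      by (simp add: \<psi>_def bump_product_def algebra_simps)
    moreover have "indicator {c<..<d} x = (if 0 < x - c then 1 else 0) * (if 0 < d - x then 1 else (0::real))"
      by (simp add: indicator_def)
    ultimately show ?thesis
      using tendsto_mult[OF lim1[of "x - c"] lim1[of "d - x"]] by presburger
  qed
  show thesis
  proof (rule that[of \<psi>])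
    fix f assume f: "f \<in> L2 a b"
    show "(\<lambda>n. L2_inner a b f (\<psi> n)) \<longlonglongrightarrow> L2_inner a b f (indicator {c<..<d})"
      unfolding L2_inner_def
    proof (rule integral_dominated_convergence[where w = "\<lambda>x. \<bar>f x\<bar>"])
      show "(\<lambda>x. f x * indicator {c<..<d} x) \<in> borel_measurable (lebesgue_on {a<..<b})"
        by (intro borel_measurable_times L2_measurable f L2_indicator) simp
      show "(\<lambda>x. f x * \<psi> n x) \<in> borel_measurable (lebesgue_on {a<..<b})" for n
        by (intro borel_measurable_times L2_measurable f test_fun_L2 test_fun_bump_space[OF mem])
      show "integrable (lebesgue_on {a<..<b}) (\<lambda>x. \<bar>f x\<bar>)"
        using L2_integrable[OF f] by simp
      show "AE x in lebesgue_on {a<..<b}. (\<lambda>n. f x * \<psi> n x) \<longlonglongrightarrow> f x * indicator {c<..<d} x"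
        by (intro AE_I2 tendsto_intros lim)
      show "AE x in lebesgue_on {a<..<b}. norm (f x * \<psi> n x) \<le> \<bar>f x\<bar>" for n
        using bounds[of n] by (intro AE_I2) (simp add: abs_mult mult_left_le)
    qed
  qed (rule mem)
qed

text \<open>Orthogonality passes to indicators of open intervals by approximation, to Borel sets
  because the intervals form an intersection-stable generator, and to Lebesgue sets up to null sets.
  A function whose integral over every measurable set is zero vanishes almost everywhere.\<close>

lemma L2_eq_0_if_orthogonal_bump:
  assumes f: "f \<in> L2 a b" and orth: "\<And>\<psi>. \<psi> \<in> bump_space a b \<Longrightarrow> L2_inner a b f \<psi> = 0"
  shows "L2_eq a b f (\<lambda>_. 0)"
proof -
  let ?M = "lebesgue_on {a<..<b}"
  define I where "I A = set_lebesgue_integral ?M (A \<inter> {a<..<b}) f" for A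
  have int: "integrable ?M f" using f by (rule L2_integrable)
  have sets: "A \<inter> {a<..<b} \<in> sets ?M" if "A \<in> sets borel" for A
    using that by (auto simp: sets_restrict_space_iff intro!: sets.Int sets_completionI_sets)
  have set_int: "set_integrable ?M (A \<inter> {a<..<b}) f" if "A \<in> sets borel" for A
    unfolding set_integrable_def using int sets[OF that] by (intro integrable_mult_indicator)
  have interval: "I {c<..<d} = 0" for c d
  proof -
    obtain \<psi> where \<psi>: "\<And>n. \<psi> n \<in> bump_space a b"
      "\<And>f. f \<in> L2 a b \<Longrightarrow>
        (\<lambda>n. L2_inner a b f (\<psi> n)) \<longlonglongrightarrow> L2_inner a b f (indicator {max a c<..<min b d})"
      by (rule bump_approximates_indicator[of a "max a c" "min b d" b]) auto
    then have "L2_inner a b f (indicator {max a c<..<min b d}) = 0"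
      using \<psi>(2)[OF f] by (simp add: orth[OF \<psi>(1)] LIMSEQ_const_iff)
    moreover have "I {c<..<d} = L2_inner a b f (indicator {max a c<..<min b d})"
      unfolding I_def set_lebesgue_integral_def L2_inner_def
      by (intro Bochner_Integration.integral_cong) (auto simp: indicator_def)
    ultimately show ?thesis by simp
  qed
  have borel: "I A = 0" if "A \<in> sets borel" for A
  proof -
    let ?G = "range (\<lambda>(c, d). {c<..<d::real})"
    have borel_eq: "sets borel = sigma_sets UNIV ?G"
      using arg_cong[OF borel_eq_box[where 'a = real], of sets] by (simp only: box_real) (simp add: sets_measure_of)
    have "Int_stable ?G"
    proof (rule Int_stableI)
      fix A B assume "A \<in> ?G" "B \<in> ?G"
      then obtain c d c' d' where "A = {c<..<d}" "B = {c'<..<d'}" by auto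
      then have "A \<inter> B = (\<lambda>(c, d). {c<..<d}) (max c c', min d d')" by auto
      then show "A \<inter> B \<in> ?G" by blast
    qed
    moreover have "?G \<subseteq> Pow UNIV" by simp
    moreover have "A \<in> sigma_sets UNIV ?G" using that borel_eq by simp
    ultimately show ?thesis
    proof (induction rule: sigma_sets_induct_disjoint)
      case (basic A)
      then show ?case using interval by auto
    next
      case empty
      show ?case by (simp add: I_def set_lebesgue_integral_def)
    next
      case (compl A)
      then have A: "A \<in> sets borel" by (simp add: borel_eq)
      have "I (A \<union> (UNIV - A)) = I A + I (UNIV - A)"
        unfolding I_def Int_Un_distrib2
        using A by (intro set_integral_Un set_int) auto
      \<comment> \<open>Complements are taken in the whole line, which counts like the interval (a,
        b), already treated.\<close>
      moreover have "I UNIV = I {a<..<b}" by (simp add: I_def)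
      ultimately show ?case using compl interval by (simp add: Un_absorb)
    next
      case (union A)
      then have A: "A i \<in> sets borel" for i by (auto simp: borel_eq)
      have "set_lebesgue_integral ?M (\<Union>i. A i \<inter> {a<..<b}) f = (\<Sum>i. I (A i))"
        unfolding I_def
      proof (rule lebesgue_integral_countable_add)
        show "set_integrable ?M (\<Union>i. A i \<inter> {a<..<b}) f"
          using set_int[of "\<Union>i. A i"] A by (simp add: sets.countable_UN)
        show "A i \<inter> {a<..<b} \<inter> (A j \<inter> {a<..<b}) = {}" if "i \<noteq> j" for i j
          using disjoint_family_onD[OF union(1) UNIV_I UNIV_I that] by auto
      qed (intro sets A)
      then show ?case using union by (simp add: I_def)
    qed
  qed
  have "AE x in ?M. f x = 0"
  proof (rule density_unique_real[OF int integrable_const_interval])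
    fix A assume A: "A \<in> sets ?M"
    then have "A \<subseteq> {a<..<b}" "A \<in> sets lebesgue"
      by (auto simp: sets_restrict_space_iff)
    then obtain B N where BN: "B \<in> sets borel" "negligible N" "B \<union> N = A"
      using sets_lebesgue_almost_borel by metis
    have N: "AE x in ?M. x \<notin> N"
      using BN(2) unfolding negligible_iff_null_sets
      by (intro AE_not_in) (use BN(3) \<open>A \<subseteq> {a<..<b}\<close> in \<open>auto simp: null_sets_restrict_space\<close>)
    have "set_lebesgue_integral ?M A f = I B"
      unfolding I_def
    proof (rule set_integral_cong_set)
      show "set_borel_measurable ?M A f" "set_borel_measurable ?M (B \<inter> {a<..<b}) f"
        using A sets[OF BN(1)] L2_measurable[OF f] unfolding set_borel_measurable_def
        by (auto intro: borel_measurable_indicator borel_measurable_times)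
      show "AE x in ?M. (x \<in> B \<inter> {a<..<b}) = (x \<in> A)"
        using N by eventually_elim (use BN(3) \<open>A \<subseteq> {a<..<b}\<close> in auto)
    qed
    then show "set_lebesgue_integral ?M A f = set_lebesgue_integral ?M A (\<lambda>_. 0)"
      using borel[OF BN(1)] by simp
  qed
  then show ?thesis by (simp add: L2_eq_def)
qed

text \<open>Allows the choice made in \<open>weak_deriv\<close> to be replaced by any explicit weak
  derivative.\<close>

lemma weak_deriv_unique:
  assumes "has_weak_deriv a b n u v" "has_weak_deriv a b n u w"
  shows "L2_eq a b v w"
proof -
  have L2: "v \<in> L2 a b" "w \<in> L2 a b" using assms by (auto simp: has_weak_deriv_def)
  have "L2_eq a b (\<lambda>x. v x - w x) (\<lambda>_. 0)"
  proof (rule L2_eq_0_if_orthogonal_bump)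
    fix \<psi> assume "\<psi> \<in> bump_space a b"
    then have \<psi>: "test_fun a b \<psi>" by (rule test_fun_bump_space)
    then have "(-1) ^ n * L2_inner a b v \<psi> = (-1) ^ n * L2_inner a b w \<psi>"
      using assms by (simp add: has_weak_deriv_def)
    then show "L2_inner a b (\<lambda>x. v x - w x) \<psi> = 0"
      using L2 test_fun_L2[OF \<psi>] by (simp add: L2_inner_diff_left)
  qed (rule L2_diff[OF L2])
  then show ?thesis by (simp add: L2_eq_def)
qed

text \<open>Fix a bump \<open>\<psi>\<^sub>0\<close> of nonzero integral. Any bump \<psi>, corrected
  by a multiple of it, has mean zero and is therefore the derivative of a test function, to which f
  is orthogonal. Hence (f, \<psi>) is a fixed multiple c of the integral of \<psi>.\<close>

lemma du_Bois_Reymond_L2: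
  assumes ab: "a < b" and f: "f \<in> L2 a b"
    and orth: "\<And>\<phi>. test_fun a b \<phi> \<Longrightarrow> L2_inner a b f (deriv \<phi>) = 0"
  obtains c where "L2_eq a b f (\<lambda>_. c)"
proof -
  obtain \<psi>\<^sub>0 where \<psi>\<^sub>0: "\<psi>\<^sub>0 \<in> bump_space a b" "L2_inner a b \<psi>\<^sub>0 (\<lambda>_. 1) \<noteq> 0"
  proof -
    \<comment> \<open>Bumps approximating the indicator of (a, b) have integrals tending to b - a >
      0, so not all of them are zero.\<close>
    obtain \<psi> where \<psi>: "\<And>n. \<psi> n \<in> bump_space a b"
      "\<And>f. f \<in> L2 a b \<Longrightarrow> (\<lambda>n. L2_inner a b f (\<psi> n)) \<longlonglongrightarrow> L2_inner a b f (indicator {a<..<b})"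
      by (rule bump_approximates_indicator[of a a b b, OF order_refl order_refl]) blast
    have "L2_inner a b (\<lambda>_. 1) (indicator {a<..<b}) = L2_inner a b (\<lambda>_. 1) (\<lambda>_. 1)"
      by (intro L2_inner_cong L2_const L2_indicator L2_eqI) auto
    also have "\<dots> = b - a"
      using ab by (simp add: L2_inner_def measure_restrict_space)
    finally have "L2_inner a b (\<lambda>_. 1) (indicator {a<..<b}) \<noteq> 0" using ab by simp
    then have "\<not> (\<lambda>_. 0) \<longlonglongrightarrow> L2_inner a b (\<lambda>_. 1) (indicator {a<..<b})"
      by (simp add: LIMSEQ_const_iff)
    then have "(\<lambda>n. L2_inner a b (\<lambda>_. 1) (\<psi> n)) \<noteq> (\<lambda>_. 0)"
      using \<psi>(2)[OF L2_const, of 1] by metis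
    then have "\<exists>n. L2_inner a b (\<lambda>_. 1) (\<psi> n) \<noteq> 0" by auto
    then show thesis using \<psi>(1) that by (metis L2_inner_commute)
  qed
  define m where "m = L2_inner a b \<psi>\<^sub>0 (\<lambda>_. 1)"
  define c where "c = L2_inner a b f \<psi>\<^sub>0 / m"
  have L2_0: "\<psi>\<^sub>0 \<in> L2 a b" using \<psi>\<^sub>0(1) by (intro test_fun_L2 test_fun_bump_space)
  have "L2_eq a b (\<lambda>x. f x - c) (\<lambda>_. 0)"
  proof (rule L2_eq_0_if_orthogonal_bump)
    show "(\<lambda>x. f x - c) \<in> L2 a b" using f by (intro L2_diff L2_const)
    fix \<psi> assume \<psi>: "\<psi> \<in> bump_space a b"
    then have L2: "\<psi> \<in> L2 a b" by (intro test_fun_L2 test_fun_bump_space)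
    define k where "k = - L2_inner a b \<psi> (\<lambda>_. 1) / m"
    have "(\<lambda>x. \<psi> x + k * \<psi>\<^sub>0 x) \<in> bump_space a b"
      using \<psi> \<psi>\<^sub>0(1) by (intro bump_space.add bump_space.scale)
    moreover have "L2_inner a b (\<lambda>x. \<psi> x + k * \<psi>\<^sub>0 x) (\<lambda>_. 1) = 0"
      using \<psi>\<^sub>0(2) L2_inner_add_left[OF L2 L2_scale[OF L2_0] L2_const]
      by (simp only: L2_inner_scale_left) (simp add: k_def m_def)
    ultimately obtain \<phi> where "test_fun a b \<phi>" "deriv \<phi> = (\<lambda>x. \<psi> x + k * \<psi>\<^sub>0 x)"
      using test_fun_antiderivative[OF ab test_fun_bump_space] by blast
    then have "L2_inner a b f (\<lambda>x. \<psi> x + k * \<psi>\<^sub>0 x) = 0" using orth by metis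
    then have "L2_inner a b f \<psi> = - k * L2_inner a b f \<psi>\<^sub>0"
      using f L2 L2_0 by (simp add: L2_inner_add_right L2_scale L2_inner_scale_right)
    also have "\<dots> = c * L2_inner a b \<psi> (\<lambda>_. 1)" by (simp add: k_def c_def)
    also have "\<dots> = L2_inner a b (\<lambda>_. c) \<psi>"
      using L2_inner_scale_left[of a b c "\<lambda>_. 1" \<psi>] by (simp add: L2_inner_commute)
    finally show "L2_inner a b (\<lambda>x. f x - c) \<psi> = 0"
      using f L2 by (simp add: L2_inner_diff_left L2_const)
  qed
  then show thesis by (intro that[of c]) (simp add: L2_eq_def)
qed

section \<open>Weak derivatives through the integration operator, and point values\<close>

lemma weak_deriv_K_op:
  assumes "a < b" "has_weak_deriv a b 1 u v"
  obtains c where "L2_eq a b u (\<lambda>x. c + K_op a v x)"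
proof -
  have L2: "u \<in> L2 a b" "v \<in> L2 a b" using assms(2) by (auto simp: has_weak_deriv_def)
  obtain c where "L2_eq a b (\<lambda>x. u x - K_op a v x) (\<lambda>_. c)"
  proof (rule du_Bois_Reymond_L2[OF assms(1)])
    show "(\<lambda>x. u x - K_op a v x) \<in> L2 a b" using L2 assms(1) by (intro L2_diff K_op_L2)
    fix \<phi> assume \<phi>: "test_fun a b \<phi>"
    then have "L2_inner a b u (deriv \<phi>) = - L2_inner a b v \<phi>"
      using assms(2) by (auto simp: has_weak_deriv_def)
    then show "L2_inner a b (\<lambda>x. u x - K_op a v x) (deriv \<phi>) = 0"
      using L2 assms(1) \<phi>
      by (simp add: L2_inner_diff_left K_op_L2 K_op_inner_deriv test_fun_L2 test_fun_deriv)
  qed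
  then have "L2_eq a b u (\<lambda>x. c + K_op a v x)"
    unfolding L2_eq_def by (rule eventually_mono) simp
  then show thesis by (rule that)
qed

lemma has_weak_deriv_K_op_funpow:
  assumes "a < b" "f \<in> L2 a b"
  shows "has_weak_deriv a b l ((K_op a ^^ (l + m)) f) ((K_op a ^^ m) f)"
proof -
  have "L2_inner a b ((K_op a ^^ (l + m)) f) ((deriv ^^ l) \<phi>) = (-1) ^ l * L2_inner a b ((K_op a ^^ m) f) \<phi>"
    if "test_fun a b \<phi>" for \<phi>
  proof (induction l)
    case (Suc l)
    then show ?case
      using assms that by (simp add: K_op_inner_deriv K_op_funpow_L2 test_fun_higher_deriv)
  qed simp
  then show ?thesis using assms by (simp add: has_weak_deriv_def K_op_funpow_L2)
qed

text \<open>The set of disagreement inside (a, b) is open and null, hence empty; the end points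
  follow by continuity. The end point a is the one at which \<open>Q_proj\<close> evaluates.\<close>

lemma continuous_L2_eq_imp_eq:
  assumes "a < b" "continuous_on {a..b} f" "continuous_on {a..b} g" "L2_eq a b f g" "x \<in> {a..b}"
  shows "f x = g x"
proof -
  let ?h = "\<lambda>x. f x - g x"
  have cont: "continuous_on {a..b} ?h" using assms(2,3) by (rule continuous_on_diff)
  let ?N = "{x \<in> {a<..<b}. ?h x \<noteq> 0}"
  have "open ?N"
  proof -
    have "open ({a<..<b} \<inter> ?h -` (- {0}))"
      by (intro continuous_open_preimage continuous_on_subset[OF cont]) auto
    moreover have "{a<..<b} \<inter> ?h -` (- {0}) = ?N" by auto
    ultimately show ?thesis by simp
  qed
  have "AE x in lebesgue. x \<in> {a<..<b} \<longrightarrow> f x = g x"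
    using assms(4) by (simp add: L2_eq_def AE_restrict_space_iff)
  then have "AE x in lebesgue. x \<notin> ?N" by eventually_elim auto
  then have "?N \<in> null_sets lebesgue" using \<open>open ?N\<close> by (simp add: AE_iff_null_sets)
  then have "?N = {}" using open_not_negligible[OF \<open>open ?N\<close>] by (auto simp: negligible_iff_null_sets)
  then have "\<And>x. x \<in> {a<..<b} \<Longrightarrow> ?h x = 0" by blast
  then have "?h x = 0"
    using continuous_constant_on_closure[of "{a<..<b}" ?h 0 x] cont assms(1,5) by simp
  then show ?thesis by simp
qed

lemma point_value_eqI:
  assumes "a < b" "continuous_on {a..b} v" "L2_eq a b u v" "x \<in> {a..b}"
  shows "point_value a b u x = v x"
  unfolding point_value_def
proof (rule the_equality)
  show "\<exists>w. continuous_on {a..b} w \<and> L2_eq a b u w \<and> w x = v x" using assms by blast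
  fix c assume "\<exists>w. continuous_on {a..b} w \<and> L2_eq a b u w \<and> w x = c"
  then obtain w where "continuous_on {a..b} w" "L2_eq a b u w" "w x = c" by blast
  then show "c = v x"
    using continuous_L2_eq_imp_eq[of a b w v x] assms L2_eq_sym L2_eq_trans by blast
qed

section \<open>Projections and error constants\<close>

text \<open>A numbered family, unlike a set of generators, keeps its length when K is applied to its
  members, and it allows induction on that length.\<close>

definition L2_generated :: "real \<Rightarrow> real \<Rightarrow> nat \<Rightarrow> (nat \<Rightarrow> real \<Rightarrow> real) \<Rightarrow> (real \<Rightarrow> real) set" where
  "L2_generated a b n g = {f \<in> L2 a b. \<exists>c. L2_eq a b f (\<lambda>x. \<Sum>i<n. c i * g i x)}"

lemma L2_generated_I:
  "f \<in> L2 a b \<Longrightarrow> L2_eq a b f (\<lambda>x. \<Sum>i<n. c i * g i x) \<Longrightarrow> f \<in> L2_generated a b n g"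
  by (auto simp: L2_generated_def)

lemma L2_generated_E:
  assumes "f \<in> L2_generated a b n g"
  obtains c where "f \<in> L2 a b" "L2_eq a b f (\<lambda>x. \<Sum>i<n. c i * g i x)"
  using assms by (auto simp: L2_generated_def)

lemma L2_generated_add:
  assumes "f \<in> L2_generated a b n g" "h \<in> L2_generated a b n g"
  shows "(\<lambda>x. f x + h x) \<in> L2_generated a b n g"
proof -
  obtain c where c: "f \<in> L2 a b" "L2_eq a b f (\<lambda>x. \<Sum>i<n. c i * g i x)"
    using assms(1) by (rule L2_generated_E)
  obtain d where d: "h \<in> L2 a b" "L2_eq a b h (\<lambda>x. \<Sum>i<n. d i * g i x)"
    using assms(2) by (rule L2_generated_E)
  show ?thesis
    using L2_eq_add[OF c(2) d(2)] L2_add[OF c(1) d(1)]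
    by (intro L2_generated_I[where c = "\<lambda>i. c i + d i"]) (simp_all add: sum.distrib distrib_right)
qed

lemma L2_generated_scale:
  assumes "f \<in> L2_generated a b n g"
  shows "(\<lambda>x. k * f x) \<in> L2_generated a b n g"
proof -
  obtain c where c: "f \<in> L2 a b" "L2_eq a b f (\<lambda>x. \<Sum>i<n. c i * g i x)"
    using assms(1) by (rule L2_generated_E)
  show ?thesis
    using L2_eq_scale[OF c(2), of k] L2_scale[OF c(1), of k]
    by (intro L2_generated_I[where c = "\<lambda>i. k * c i"]) (simp_all add: sum_distrib_left mult.assoc)
qed

lemma L2_generated_Suc:
  assumes "f \<in> L2_generated a b n g"
  shows "f \<in> L2_generated a b (Suc n) g"
proof -
  obtain c where c: "f \<in> L2 a b" "L2_eq a b f (\<lambda>x. \<Sum>i<n. c i * g i x)"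
    using assms(1) by (rule L2_generated_E)
  then show ?thesis by (intro L2_generated_I[where c = "\<lambda>i. if i < n then c i else 0"]) simp_all
qed

lemma L2_generated_last:
  assumes "g n \<in> L2 a b"
  shows "g n \<in> L2_generated a b (Suc n) g"
  using assms by (intro L2_generated_I[where c = "\<lambda>i. if i = n then 1 else 0"]) (simp_all add: if_distrib cong: if_cong)

text \<open>One Gram-Schmidt step; if \<open>e\<close> vanishes then division by zero makes \<open>k\<close> vanish as well.\<close>

lemma L2_generated_projection:
  assumes "\<And>i. i < n \<Longrightarrow> g i \<in> L2 a b" "f \<in> L2 a b"
  shows "\<exists>p \<in> L2_generated a b n g. \<forall>v \<in> L2_generated a b n g. L2_inner a b (\<lambda>x. f x - p x) v = 0"
  using assms
proof (induction n arbitrary: f)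
  case 0
  have "L2_inner a b (\<lambda>x. f x - 0) v = 0" if "v \<in> L2_generated a b 0 g" for v
  proof -
    from that have "v \<in> L2 a b" "L2_eq a b v (\<lambda>_. 0)" by (auto simp: L2_generated_def)
    then have "L2_inner a b f v = L2_inner a b f (\<lambda>_. 0)"
      using 0 by (intro L2_inner_cong L2_const L2_eq_refl) auto
    then show ?thesis by (simp add: L2_inner_def)
  qed
  moreover have "(\<lambda>_. 0) \<in> L2_generated a b 0 g"
    by (rule L2_generated_I) (simp_all add: L2_const)
  ultimately show ?case by (intro bexI[of _ "\<lambda>_. 0"]) auto
next
  case (Suc n)
  have gn: "g n \<in> L2 a b" using Suc.prems(1) by simp
  obtain p where p: "p \<in> L2_generated a b n g"
      "\<And>v. v \<in> L2_generated a b n g \<Longrightarrow> L2_inner a b (\<lambda>x. f x - p x) v = 0"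
    using Suc.IH[of f] Suc.prems by force
  obtain h where h: "h \<in> L2_generated a b n g"
      "\<And>v. v \<in> L2_generated a b n g \<Longrightarrow> L2_inner a b (\<lambda>x. g n x - h x) v = 0"
    using Suc.IH[of "g n"] Suc.prems by force
  define e where "e = (\<lambda>x. g n x - h x)"
  define d where "d = (\<lambda>x. f x - p x)"
  define k where "k = L2_inner a b d e / L2_inner a b e e"
  have L2: "p \<in> L2 a b" "h \<in> L2 a b" using p(1) h(1) by (auto simp: L2_generated_def)
  have L2_e: "e \<in> L2 a b" unfolding e_def using gn L2(2) by (rule L2_diff)
  have L2_d: "d \<in> L2 a b" unfolding d_def using Suc.prems(2) L2(1) by (rule L2_diff)
  have de: "L2_inner a b d e = k * L2_inner a b e e"
  proof (cases "L2_inner a b e e = 0")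
    case True
    \<comment> \<open>If e has norm zero, Cauchy-Schwarz makes (d, e) zero too.\<close>
    then show ?thesis using Cauchy_Schwarz_L2[OF L2_d L2_e] by (simp add: L2_norm_def)
  qed (simp add: k_def)
  have inner: "L2_inner a b (\<lambda>x. d x - k * e x) v = L2_inner a b d v - k * L2_inner a b e v"
    if "v \<in> L2 a b" for v
    using that L2_d L2_e by (simp add: L2_inner_diff_left L2_scale L2_inner_scale_left)
  have low: "L2_inner a b (\<lambda>x. d x - k * e x) v = 0" if "v \<in> L2_generated a b n g" for v
    using that p(2) h(2) inner[of v] by (simp add: L2_generated_def d_def e_def)
  have "L2_inner a b (\<lambda>x. d x - k * e x) e = 0" using inner[OF L2_e] de by simp
  then have "L2_inner a b (\<lambda>x. d x - k * e x) (\<lambda>x. e x + h x) = 0"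
    using low[OF h(1)] L2_inner_add_right[OF L2_e L2(2) L2_diff[OF L2_d L2_scale[OF L2_e]]] by simp
  then have last: "L2_inner a b (\<lambda>x. d x - k * e x) (g n) = 0" by (simp add: e_def)
  show ?case
  proof (intro bexI[of _ "\<lambda>x. p x + (k * g n x + (- k) * h x)"] ballI)
    show "(\<lambda>x. p x + (k * g n x + (- k) * h x)) \<in> L2_generated a b (Suc n) g"
      using p(1) h(1) gn
      by (intro L2_generated_add L2_generated_scale L2_generated_last) (auto intro: L2_generated_Suc)
    fix v assume "v \<in> L2_generated a b (Suc n) g"
    then obtain c where c: "v \<in> L2 a b" "L2_eq a b v (\<lambda>x. \<Sum>i<Suc n. c i * g i x)"
      by (rule L2_generated_E)
    let ?v = "\<lambda>x. \<Sum>i<n. c i * g i x"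
    have v: "?v \<in> L2 a b" using Suc.prems(1) by (intro L2_finite_sum L2_scale) simp
    then have v_mem: "?v \<in> L2_generated a b n g" by (intro L2_generated_I[where c = c]) auto
    have r: "(\<lambda>x. d x - k * e x) \<in> L2 a b" using L2_d L2_e by (intro L2_diff L2_scale)
    have "L2_inner a b (\<lambda>x. d x - k * e x) v = L2_inner a b (\<lambda>x. d x - k * e x) (\<lambda>x. ?v x + c n * g n x)"
      using c r v gn by (intro L2_inner_cong L2_add L2_scale L2_eq_refl) auto
    also have "\<dots> = 0"
      using low[OF v_mem] last v gn r by (simp add: L2_inner_add_right L2_scale L2_inner_scale_right)
    finally show "L2_inner a b (\<lambda>x. f x - (p x + (k * g n x + (- k) * h x))) v = 0"
      by (simp add: d_def e_def algebra_simps)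
  qed
qed

lemma finite_dim_subspace_generated:
  assumes "finite_dim_subspace a b V"
  obtains n g where "\<And>i. i < n \<Longrightarrow> g i \<in> L2 a b" "V = L2_generated a b n g"
proof -
  obtain B where B: "finite B" "B \<subseteq> L2 a b" "V = L2_span a b B"
    using assms by (auto simp: finite_dim_subspace_def)
  obtain g where g: "bij_betw g {0..<card B} B" using ex_bij_betw_nat_finite[OF B(1)] by blast
  let ?S = "{(\<lambda>x. \<Sum>h\<in>B. c h * h x) | c. True}"
  let ?T = "{(\<lambda>x. \<Sum>i<card B. c i * g i x) | c. True}"
  have reindex: "(\<Sum>h\<in>B. c h * h x) = (\<Sum>i<card B. c (g i) * g i x)" for c x
    using sum.reindex_bij_betw[OF g, of "\<lambda>h. c h * h x"] by (simp add: lessThan_atLeast0)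
  have "?S = ?T"
  proof
    show "?S \<subseteq> ?T"
    proof
      fix f assume "f \<in> ?S"
      then obtain c where "f = (\<lambda>x. \<Sum>h\<in>B. c h * h x)" by blast
      then have "f = (\<lambda>x. \<Sum>i<card B. c (g i) * g i x)" by (simp only: reindex)
      then show "f \<in> ?T" by (intro CollectI exI[of _ "\<lambda>i. c (g i)"] conjI TrueI)
    qed
    show "?T \<subseteq> ?S"
    proof
      fix f assume "f \<in> ?T"
      then obtain c where f: "f = (\<lambda>x. \<Sum>i<card B. c i * g i x)" by blast
      have "f = (\<lambda>x. \<Sum>h\<in>B. c (inv_into {0..<card B} g h) * h x)"
        unfolding f reindex using g
        by (intro ext sum.cong refl) (simp add: bij_betw_inv_into_left)
      then show "f \<in> ?S" by (intro CollectI exI[of _ "\<lambda>h. c (inv_into {0..<card B} g h)"] conjI TrueI)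
    qed
  qed
  then have "V = L2_generated a b (card B) g"
    unfolding B(3) L2_span_def L2_saturate_def L2_generated_def by auto
  moreover have "g i \<in> L2 a b" if "i < card B" for i
    using that g B(2) by (auto simp: bij_betw_def)
  ultimately show thesis using that by blast
qed

text \<open>The next space is generated by the K-images of the old generators, with the constant 1
  appended at index n.\<close>

lemma Z_space_generated:
  assumes "a < b" "finite_dim_subspace a b Z0"
  shows "\<exists>n g. (\<forall>i<n. g i \<in> L2 a b) \<and> Z_space a b Z0 t = L2_generated a b n g"
proof (induction t)
  case 0
  show ?case using finite_dim_subspace_generated[OF assms(2)] by (metis Z_space.simps(1))
next
  case (Suc t)
  then obtain n g where g: "\<And>i. i < n \<Longrightarrow> g i \<in> L2 a b" and Z: "Z_space a b Z0 t = L2_generated a b n g"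
    by blast
  define g' where "g' i = (if i < n then K_op a (g i) else (\<lambda>_. 1))" for i
  have sum_L2: "(\<lambda>x. \<Sum>i<n. c i * g i x) \<in> L2 a b" for c
    using g by (intro L2_finite_sum L2_scale) simp
  have K_sum: "K_op a (\<lambda>x. \<Sum>i<n. c i * g i x) x = (\<Sum>i<n. c i * g' i x)" if "a < x" "x < b" for c x
  proof -
    have "K_op a (\<lambda>x. \<Sum>i<n. c i * g i x) x = (\<Sum>i<n. K_op a (\<lambda>x. c i * g i x) x)"
      using assms(1) that g by (intro K_op_sum[where b = b] L2_scale) auto
    also have "\<dots> = (\<Sum>i<n. c i * g' i x)"
      using assms(1) that g by (intro sum.cong) (auto simp: g'_def intro!: K_op_scale[where b = b])
    finally show ?thesis .
  qed
  have "Z_space a b Z0 (Suc t) = L2_generated a b (Suc n) g'"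
  proof (intro set_eqI iffI)
    fix f assume "f \<in> Z_space a b Z0 (Suc t)"
    then obtain p v where f: "f \<in> L2 a b" "L2_eq a b f (\<lambda>x. p x + K_op a v x)"
      and p: "p \<in> poly_space a b 0" and v: "v \<in> L2_generated a b n g"
      by (auto simp: L2_sum_def L2_saturate_def Z)
    obtain d where d: "L2_eq a b p (\<lambda>_. d)"
    proof -
      obtain P where "L2_eq a b p (poly P)" "P = 0 \<or> int (degree P) \<le> 0"
        using p by (rule poly_space_E)
      moreover from this(2) have "degree P = 0" by auto
      then obtain d where "P = [:d:]" by (rule degree_eq_zeroE)
      ultimately show thesis using that[of d] by (simp add: L2_eq_def)
    qed
    obtain c where c: "v \<in> L2 a b" "L2_eq a b v (\<lambda>x. \<Sum>i<n. c i * g i x)"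
      using v by (rule L2_generated_E)
    have "L2_eq a b (K_op a v) (\<lambda>x. \<Sum>i<n. c i * g' i x)"
      using K_op_cong[OF assms(1) c(1) sum_L2 c(2)] K_sum by (intro L2_eqI) simp
    from L2_eq_trans[OF f(2) L2_eq_add[OF d this]]
    have "L2_eq a b f (\<lambda>x. \<Sum>i<Suc n. (if i < n then c i else d) * g' i x)"
      by (simp add: g'_def add.commute)
    then show "f \<in> L2_generated a b (Suc n) g'" using f(1) by (intro L2_generated_I)
  next
    fix f assume "f \<in> L2_generated a b (Suc n) g'"
    then obtain c where c: "f \<in> L2 a b" "L2_eq a b f (\<lambda>x. \<Sum>i<Suc n. c i * g' i x)"
      by (rule L2_generated_E)
    let ?v = "\<lambda>x. \<Sum>i<n. c i * g i x"
    have "?v \<in> Z_space a b Z0 t"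
      unfolding Z using sum_L2 by (intro L2_generated_I[where c = c]) auto
    moreover have "(\<lambda>_. c n) \<in> poly_space a b 0" by (simp add: poly_space_const)
    moreover have "L2_eq a b (\<lambda>x. \<Sum>i<Suc n. c i * g' i x) (\<lambda>x. c n + K_op a ?v x)"
      using K_sum by (intro L2_eqI) (simp add: g'_def)
    then have "L2_eq a b f (\<lambda>x. c n + K_op a ?v x)" using c(2) L2_eq_trans by blast
    moreover have "(\<lambda>x. c n + K_op a ?v x)
        \<in> {(\<lambda>x. f x + h x) | f h. f \<in> poly_space a b 0 \<and> h \<in> K_op a ` Z_space a b Z0 t}"
      using calculation(1,2)
      by (intro CollectI exI[of _ "\<lambda>_. c n"] exI[of _ "K_op a ?v"] conjI imageI refl)
    ultimately show "f \<in> Z_space a b Z0 (Suc t)"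
      using c(1) unfolding Z_space.simps L2_sum_def L2_saturate_def by - (rule CollectI, rule conjI, assumption, rule bexI)
  qed
  moreover have "\<forall>i<Suc n. g' i \<in> L2 a b"
    using g assms(1) by (auto simp: g'_def intro: K_op_L2 L2_const)
  ultimately show ?case by blast
qed

section \<open>Residuals and error constants of a fixed subspace\<close>

locale L2_projection =
  fixes a b :: real and V :: "(real \<Rightarrow> real) set"
  assumes ab: "a < b"
    and V_L2: "V \<subseteq> L2 a b"
    and V_add: "f \<in> V \<Longrightarrow> g \<in> V \<Longrightarrow> (\<lambda>x. f x + g x) \<in> V"
    and V_scale: "f \<in> V \<Longrightarrow> (\<lambda>x. k * f x) \<in> V"
    and V_cong: "f \<in> V \<Longrightarrow> g \<in> L2 a b \<Longrightarrow> L2_eq a b g f \<Longrightarrow> g \<in> V"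
    and projection_exists: "f \<in> L2 a b \<Longrightarrow> \<exists>p\<in>V. \<forall>v\<in>V. L2_inner a b (\<lambda>x. f x - p x) v = 0"
begin

definition residual :: "(real \<Rightarrow> real) \<Rightarrow> real \<Rightarrow> real" where
  "residual f = (\<lambda>x. f x - orth_proj a b V f x)"

lemma orth_proj:
  assumes "f \<in> L2 a b"
  shows "orth_proj a b V f \<in> V" "v \<in> V \<Longrightarrow> L2_inner a b (residual f) v = 0"
proof -
  have "\<exists>p. p \<in> V \<and> (\<forall>v\<in>V. L2_inner a b (\<lambda>x. f x - p x) v = 0)"
    using projection_exists[OF assms] by blast
  from someI_ex[OF this]
  show "orth_proj a b V f \<in> V" "v \<in> V \<Longrightarrow> L2_inner a b (residual f) v = 0"
    unfolding orth_proj_def[symmetric] residual_def by auto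
qed

lemma orth_proj_L2: "f \<in> L2 a b \<Longrightarrow> orth_proj a b V f \<in> L2 a b"
  using orth_proj(1) V_L2 by blast

lemma residual_L2: "f \<in> L2 a b \<Longrightarrow> residual f \<in> L2 a b"
  unfolding residual_def by (intro L2_diff orth_proj_L2)

lemma V_diff: "f \<in> V \<Longrightarrow> g \<in> V \<Longrightarrow> (\<lambda>x. f x - g x) \<in> V"
  using V_add[OF _ V_scale[of g "-1"]] by simp

text \<open>The difference of the two residuals lies in V and is orthogonal to V, so its norm is
  zero. This serves as linearity of the chosen projector: c is a scaling factor in
  \<open>error_const_bound\<close>, and c = 1 lets elements of V be discarded.\<close>

lemma residual_eq:
  assumes f: "f \<in> L2 a b" and g: "g \<in> L2 a b" and fg: "(\<lambda>x. f x - c * g x) \<in> V"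
  shows "L2_eq a b (residual f) (\<lambda>x. c * residual g x)"
proof -
  define d where "d = (\<lambda>x. residual f x - c * residual g x)"
  have d_L2: "d \<in> L2 a b"
    unfolding d_def using f g by (intro L2_diff L2_scale residual_L2)
  have "(\<lambda>x. (f x - c * g x) - (orth_proj a b V f x - c * orth_proj a b V g x)) \<in> V"
    by (intro V_diff[OF fg V_diff[OF orth_proj(1)[OF f] V_scale[OF orth_proj(1)[OF g]]]])
  also have "(\<lambda>x. (f x - c * g x) - (orth_proj a b V f x - c * orth_proj a b V g x)) = d"
    by (simp add: d_def residual_def algebra_simps)
  finally have "d \<in> V" .
  then have "L2_inner a b (residual f) d = 0" "L2_inner a b (residual g) d = 0"
    using orth_proj(2) f g by auto
  moreover have "L2_inner a b d d = L2_inner a b (residual f) d - c * L2_inner a b (residual g) d"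
    using f g d_L2 L2_inner_diff_left[of "residual f" a b "\<lambda>x. c * residual g x" d]
    by (simp add: residual_L2 L2_scale L2_inner_scale_left flip: d_def)
  ultimately have "L2_norm a b d = 0" by (simp add: L2_norm_def)
  then have "L2_eq a b d (\<lambda>_. 0)" using L2_norm_eq_0_iff[OF d_L2] by simp
  then show ?thesis by (simp add: L2_eq_def d_def)
qed

lemma L2_norm_residual_le:
  assumes f: "f \<in> L2 a b"
  shows "L2_norm a b (residual f) \<le> L2_norm a b f"
proof -
  have "(L2_norm a b (residual f))\<^sup>2
      = L2_inner a b (residual f) f - L2_inner a b (residual f) (orth_proj a b V f)"
    unfolding L2_norm_power2 using f
    by (subst (2) residual_def) (intro L2_inner_diff_right orth_proj_L2 residual_L2)
  also have "\<dots> = L2_inner a b (residual f) f" using f by (simp add: orth_proj)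
  also have "\<dots> \<le> L2_norm a b (residual f) * L2_norm a b f"
    using Cauchy_Schwarz_L2[OF residual_L2[OF f] f] by simp
  finally show ?thesis
    using L2_norm_nonneg[of a b f] L2_norm_nonneg[of a b "residual f"]
    by (auto simp: power2_eq_square mult_le_cancel_left)
qed

definition error_const :: "nat \<Rightarrow> real" where
  "error_const s = L2_opnorm a b (\<lambda>f. residual ((K_op a ^^ s) f))"

lemma L2_norm_residual_K_op_le:
  assumes "f \<in> L2 a b"
  shows "L2_norm a b (residual ((K_op a ^^ s) f)) \<le> (b - a) ^ s * L2_norm a b f"
  using L2_norm_residual_le[OF K_op_funpow_L2[OF ab assms]] L2_norm_K_op_funpow_le[OF ab assms]
  by (rule order_trans)

lemma error_const_upper:
  assumes "f \<in> L2 a b" "L2_norm a b f \<le> 1"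
  shows "L2_norm a b (residual ((K_op a ^^ s) f)) \<le> error_const s"
  unfolding error_const_def L2_opnorm_def
proof (rule cSUP_upper)
  show "f \<in> {f \<in> L2 a b. L2_norm a b f \<le> 1}" using assms by simp
  show "bdd_above ((\<lambda>f. L2_norm a b (residual ((K_op a ^^ s) f))) ` {f \<in> L2 a b. L2_norm a b f \<le> 1})"
  proof (rule bdd_aboveI2)
    fix f assume "f \<in> {f \<in> L2 a b. L2_norm a b f \<le> 1}"
    then have "L2_norm a b (residual ((K_op a ^^ s) f)) \<le> (b - a) ^ s * L2_norm a b f"
        "(b - a) ^ s * L2_norm a b f \<le> (b - a) ^ s * 1"
      using ab by (auto intro: L2_norm_residual_K_op_le mult_left_mono)
    then show "L2_norm a b (residual ((K_op a ^^ s) f)) \<le> (b - a) ^ s" by simp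
  qed
qed

lemma error_const_nonneg: "0 \<le> error_const s"
proof -
  have "L2_norm a b (\<lambda>_. 0) \<le> 1" by (simp add: L2_norm_def L2_inner_def)
  from error_const_upper[OF L2_const this] show ?thesis
    using L2_norm_nonneg order_trans by blast
qed

text \<open>Rescaling to the unit ball. A function of norm zero cannot be normalised and is covered
  by boundedness of K.\<close>

lemma error_const_bound:
  assumes f: "f \<in> L2 a b"
  shows "L2_norm a b (residual ((K_op a ^^ s) f)) \<le> error_const s * L2_norm a b f"
proof (cases "L2_norm a b f = 0")
  case True
  then show ?thesis using L2_norm_residual_K_op_le[OF f, of s] by simp
next
  case False
  then have pos: "0 < L2_norm a b f" using L2_norm_nonneg[of a b f] by linarith
  define k where "k = 1 / L2_norm a b f"
  let ?g = "\<lambda>x. k * f x"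
  have L2: "?g \<in> L2 a b" "(K_op a ^^ s) ?g \<in> L2 a b" "(K_op a ^^ s) f \<in> L2 a b"
    using f ab by (auto intro: L2_scale K_op_funpow_L2)
  have "L2_norm a b ?g \<le> 1" using pos by (simp only: L2_norm_scale) (simp add: k_def)
  then have "L2_norm a b (residual ((K_op a ^^ s) ?g)) \<le> error_const s"
    using L2(1) by (intro error_const_upper)
  moreover have "(\<lambda>x. (K_op a ^^ s) ?g x - k * (K_op a ^^ s) f x) \<in> V"
  proof (rule V_cong)
    \<comment> \<open>K^s (k f) and k K^s f agree only almost everywhere, so their difference is a
      null function. The zero of V is obtained as a multiple of a known member.\<close>
    show "(\<lambda>x. 0 * orth_proj a b V f x) \<in> V" by (intro V_scale orth_proj f)
    show "L2_eq a b (\<lambda>x. (K_op a ^^ s) ?g x - k * (K_op a ^^ s) f x) (\<lambda>x. 0 * orth_proj a b V f x)"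
      using K_op_funpow_scale[OF ab f, of s k] by (simp add: L2_eq_def)
  qed (use L2 in \<open>intro L2_diff L2_scale\<close>)
  from L2_norm_cong[OF residual_L2[OF L2(2)] L2_scale[OF residual_L2[OF L2(3)]] residual_eq[OF L2(2,3) this]]
  have "L2_norm a b (residual ((K_op a ^^ s) ?g)) = k * L2_norm a b (residual ((K_op a ^^ s) f))"
    using pos by (simp only: L2_norm_scale) (simp add: k_def)
  ultimately have "k * L2_norm a b (residual ((K_op a ^^ s) f)) \<le> error_const s" by simp
  then show ?thesis using pos by (simp add: k_def divide_le_eq)
qed

text \<open>The operators \<open>K\<^sup>s (I - Z)\<close> and \<open>(I - Z) (K\<^sup>*)\<^sup>s\<close> are adjoint to each other, and the
  latter agrees with \<open>(I - Z) K\<^sup>s\<close> up to sign when \<open>Z\<close> preserves polynomials of degree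
  below \<open>s\<close>.\<close>

lemma L2_norm_K_op_orthogonal_le:
  assumes e: "e \<in> L2 a b" and orth: "\<And>v. v \<in> V \<Longrightarrow> L2_inner a b e v = 0"
    and poly: "poly_space a b (int s - 1) \<subseteq> V"
  shows "L2_norm a b ((K_op a ^^ s) e) \<le> error_const s * L2_norm a b e"
proof -
  define g where "g = (K_op a ^^ s) e"
  have g: "g \<in> L2 a b" "(K_op a ^^ s) g \<in> L2 a b" using ab e by (simp_all add: g_def K_op_funpow_L2)
  have "(L2_norm a b g)\<^sup>2 = L2_inner a b ((K_op a ^^ s) e) g" by (simp add: L2_norm_power2 g_def)
  also have "\<dots> = (-1) ^ s * L2_inner a b e ((K_op a ^^ s) g)"
    using ab e g(1) orth poly by (intro K_op_funpow_inner) auto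
  \<comment> \<open>As e is orthogonal to V, the projection of K^s g can be subtracted at no
    cost.\<close>
  also have "L2_inner a b e ((K_op a ^^ s) g) = L2_inner a b e (residual ((K_op a ^^ s) g))"
    unfolding residual_def using e g(2) by (simp add: L2_inner_diff_right orth_proj_L2 orth_proj orth)
  also have "(-1) ^ s * \<dots> \<le> \<bar>\<dots>\<bar>"
    by (cases "even s") simp_all
  also have "\<dots> \<le> L2_norm a b e * L2_norm a b (residual ((K_op a ^^ s) g))"
    using e g by (intro Cauchy_Schwarz_L2 residual_L2)
  also have "\<dots> \<le> L2_norm a b e * (error_const s * L2_norm a b g)"
    using g(1) by (intro mult_left_mono error_const_bound L2_norm_nonneg)
  finally have "L2_norm a b g * L2_norm a b g \<le> (error_const s * L2_norm a b e) * L2_norm a b g"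
    by (simp add: power2_eq_square algebra_simps)
  then show ?thesis
    unfolding g_def[symmetric]
    using L2_norm_nonneg[of a b g] mult_nonneg_nonneg[OF error_const_nonneg[of s] L2_norm_nonneg[of a b e]]
    by (cases "L2_norm a b g = 0") (auto simp: mult_le_cancel_right)
qed

end

lemma L2_projection_Z_space:
  assumes "a < b" "finite_dim_subspace a b Z0"
  shows "L2_projection a b (Z_space a b Z0 t)"
proof -
  obtain n g where g: "\<And>i. i < n \<Longrightarrow> g i \<in> L2 a b" and Z: "Z_space a b Z0 t = L2_generated a b n g"
    using Z_space_generated[OF assms] by blast
  show ?thesis unfolding Z
  proof
    show "f \<in> L2_generated a b n g" if "h \<in> L2_generated a b n g" "f \<in> L2 a b" "L2_eq a b f h" for f h
      using that(1)
    proof (rule L2_generated_E)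
      fix c assume "L2_eq a b h (\<lambda>x. \<Sum>i<n. c i * g i x)"
      then show ?thesis using that(2,3) L2_eq_trans by (blast intro: L2_generated_I)
    qed
    show "L2_generated a b n g \<subseteq> L2 a b" by (auto simp: L2_generated_def)
  qed (use assms(1) g in \<open>auto intro: L2_generated_add L2_generated_scale L2_generated_projection\<close>)
qed

lemma C_const_eq:
  assumes "a < b" "finite_dim_subspace a b Z0"
  shows "C_const a b Z0 t s = L2_projection.error_const a b (Z_space a b Z0 t) s"
  unfolding C_const_def Z_proj_def
    L2_projection.error_const_def[OF L2_projection_Z_space[OF assms]]
    L2_projection.residual_def[OF L2_projection_Z_space[OF assms]] ..

section \<open>Sobolev functions, Taylor's formula and the error of the recursive projectors\<close>

lemma has_weak_deriv_0: "u \<in> L2 a b \<Longrightarrow> has_weak_deriv a b 0 u u"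
  by (simp add: has_weak_deriv_def)

lemma has_weak_deriv_cong:
  assumes "has_weak_deriv a b n u v" "w \<in> L2 a b" "L2_eq a b w u"
  shows "has_weak_deriv a b n w v"
proof -
  have "L2_inner a b w ((deriv ^^ n) \<phi>) = L2_inner a b u ((deriv ^^ n) \<phi>)" if "test_fun a b \<phi>" for \<phi>
    using assms that
    by (intro L2_inner_cong L2_eq_refl) (auto simp: has_weak_deriv_def intro: test_fun_L2 test_fun_higher_deriv)
  then show ?thesis using assms by (simp add: has_weak_deriv_def)
qed

lemma has_weak_deriv_weak_deriv: "has_weak_deriv a b n u v \<Longrightarrow> has_weak_deriv a b n u (weak_deriv a b n u)"
  unfolding weak_deriv_def by (rule someI[where P = "has_weak_deriv a b n u"])

lemma weak_deriv_L2_eq: "has_weak_deriv a b n u v \<Longrightarrow> L2_eq a b (weak_deriv a b n u) v"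
  using has_weak_deriv_weak_deriv weak_deriv_unique by blast

lemma Sobolev_weak_deriv:
  assumes "u \<in> Sobolev a b r" "n \<le> r"
  shows "has_weak_deriv a b n u (weak_deriv a b n u)"
proof -
  have "\<exists>v. has_weak_deriv a b n u v"
    using assms by (cases "n = 0") (auto simp: Sobolev_def intro: has_weak_deriv_0)
  then show ?thesis using has_weak_deriv_weak_deriv by blast
qed

text \<open>Test the first derivative against the n-th derivative of \<phi>, which is again a test
  function.\<close>

lemma has_weak_deriv_of_weak_deriv:
  assumes "has_weak_deriv a b 1 u w" "has_weak_deriv a b (Suc n) u v"
  shows "has_weak_deriv a b n w v"
proof -
  have "L2_inner a b w ((deriv ^^ n) \<phi>) = (-1) ^ n * L2_inner a b v \<phi>" if "test_fun a b \<phi>" for \<phi>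
  proof -
    have "L2_inner a b u (deriv ((deriv ^^ n) \<phi>)) = - L2_inner a b w ((deriv ^^ n) \<phi>)"
      using assms(1) test_fun_higher_deriv[OF that] by (auto simp: has_weak_deriv_def)
    moreover have "L2_inner a b u (deriv ((deriv ^^ n) \<phi>)) = (-1) ^ Suc n * L2_inner a b v \<phi>"
      using assms(2) that by (auto simp: has_weak_deriv_def)
    ultimately show ?thesis by simp
  qed
  then show ?thesis using assms by (simp add: has_weak_deriv_def)
qed

text \<open>The function that \<open>Q_proj\<close> literally produces by recursion;
  \<open>weak_deriv a b n\<close> is a single choice and matches it only almost everywhere.\<close>

abbreviation iterated_weak_deriv :: "real \<Rightarrow> real \<Rightarrow> nat \<Rightarrow> (real \<Rightarrow> real) \<Rightarrow> real \<Rightarrow> real" where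
  "iterated_weak_deriv a b n \<equiv> weak_deriv a b 1 ^^ n"

lemma Sobolev_Suc_weak_deriv:
  assumes "u \<in> Sobolev a b (Suc r)"
  shows "weak_deriv a b 1 u \<in> Sobolev a b r"
proof -
  have 1: "has_weak_deriv a b 1 u (weak_deriv a b 1 u)" using assms by (rule Sobolev_weak_deriv) simp
  moreover have "\<exists>v. has_weak_deriv a b n (weak_deriv a b 1 u) v" if "n \<le> r" for n
    using has_weak_deriv_of_weak_deriv[OF 1 Sobolev_weak_deriv[OF assms]] that by blast
  ultimately show ?thesis by (simp add: Sobolev_def has_weak_deriv_def)
qed

lemma Sobolev_iterated_weak_deriv:
  "u \<in> Sobolev a b (q + m) \<Longrightarrow> iterated_weak_deriv a b q u \<in> Sobolev a b m"
proof (induction q arbitrary: u)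
  case (Suc q)
  then show ?case
    using Suc.IH[of "weak_deriv a b 1 u"] Sobolev_Suc_weak_deriv by (simp add: funpow_Suc_right del: funpow.simps)
qed simp

lemma Sobolev_mono: "m \<le> n \<Longrightarrow> Sobolev a b n \<subseteq> Sobolev a b m"
  by (auto simp: Sobolev_def)

lemma iterated_weak_deriv_eq:
  assumes "u \<in> Sobolev a b r"
  shows "L2_eq a b (iterated_weak_deriv a b r u) (weak_deriv a b r u)"
proof -
  \<comment> \<open>A remaining order n is carried along so that the induction can peel off the
    innermost derivative. At n = 0 a weak derivative is just another representative.\<close>
  have "has_weak_deriv a b n (iterated_weak_deriv a b q u) v"
    if "u \<in> Sobolev a b q" "has_weak_deriv a b (q + n) u v" for q n u v
    using that
  proof (induction q arbitrary: u)
    case (Suc q)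
    have "has_weak_deriv a b 1 u (weak_deriv a b 1 u)"
      by (rule Sobolev_weak_deriv[OF Suc.prems(1)]) simp
    moreover have "has_weak_deriv a b (Suc (q + n)) u v" using Suc.prems(2) by simp
    ultimately have "has_weak_deriv a b (q + n) (weak_deriv a b 1 u) v"
      by (rule has_weak_deriv_of_weak_deriv)
    then show ?case
      using Suc.IH[OF Sobolev_Suc_weak_deriv[OF Suc.prems(1)]]
      by (simp add: funpow_Suc_right del: funpow.simps)
  qed simp
  from this[OF assms, of 0] Sobolev_weak_deriv[OF assms]
  have "has_weak_deriv a b 0 (iterated_weak_deriv a b r u) (weak_deriv a b r u)" by simp
  moreover from this have "has_weak_deriv a b 0 (iterated_weak_deriv a b r u) (iterated_weak_deriv a b r u)"
    by (simp add: has_weak_deriv_def)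
  ultimately show ?thesis using weak_deriv_unique by blast
qed

lemma Sobolev_L2: "u \<in> Sobolev a b r \<Longrightarrow> u \<in> L2 a b"
  by (simp add: Sobolev_def)

text \<open>The constant of integration is read off from the continuous representative at a, where K
  vanishes.\<close>

lemma Sobolev_Suc_K_op:
  assumes "a < b" "u \<in> Sobolev a b (Suc r)"
  shows "L2_eq a b u (\<lambda>x. point_value a b u a + K_op a (weak_deriv a b 1 u) x)"
proof -
  have D: "weak_deriv a b 1 u \<in> L2 a b" using Sobolev_Suc_weak_deriv[OF assms(2)] by (rule Sobolev_L2)
  obtain c where c: "L2_eq a b u (\<lambda>x. c + K_op a (weak_deriv a b 1 u) x)"
    using weak_deriv_K_op[OF assms(1) Sobolev_weak_deriv[OF assms(2)]] by auto
  have "point_value a b u a = c + K_op a (weak_deriv a b 1 u) a"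
    using assms(1) c
    by (intro point_value_eqI[where v = "\<lambda>x. c + K_op a (weak_deriv a b 1 u) x"]
        continuous_intros continuous_on_K_op D) auto
  then show ?thesis using c by simp
qed

text \<open>Taylor's formula with the remainder as an r-fold integral: expand the derivative and
  integrate once. For r = 0 the polynomial space is zero.\<close>

lemma Sobolev_Taylor:
  assumes "a < b" "u \<in> Sobolev a b r"
  shows "\<exists>w \<in> poly_space a b (int r - 1).
    L2_eq a b u (\<lambda>x. w x + (K_op a ^^ r) (iterated_weak_deriv a b r u) x)"
  using assms(2)
proof (induction r arbitrary: u)
  case 0
  have "(\<lambda>_. 0) \<in> poly_space a b (- 1)"
    by (rule poly_space_I[where p = 0]) (auto intro: L2_const L2_eqI)
  then show ?case by (intro bexI[of _ "\<lambda>_. 0"]) auto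
next
  case (Suc r)
  let ?D = "weak_deriv a b 1 u"
  let ?g = "(K_op a ^^ r) (iterated_weak_deriv a b r ?D)"
  have D: "?D \<in> Sobolev a b r" using Suc.prems by (rule Sobolev_Suc_weak_deriv)
  from Suc.IH[OF D] obtain w where w: "w \<in> poly_space a b (int r - 1)" "L2_eq a b ?D (\<lambda>x. w x + ?g x)"
    by blast
  have w_L2: "w \<in> L2 a b" using w(1) by (rule poly_space_E)
  have "iterated_weak_deriv a b r ?D \<in> L2 a b"
    using Sobolev_iterated_weak_deriv[of ?D a b r 0] D by (auto intro: Sobolev_L2)
  then have g_L2: "?g \<in> L2 a b" using assms(1) by (intro K_op_funpow_L2)
  have "L2_eq a b (K_op a ?D) (\<lambda>x. K_op a w x + K_op a ?g x)"
    using K_op_cong[OF assms(1) Sobolev_L2[OF D] L2_add[OF w_L2 g_L2] w(2)]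
      K_op_add[OF assms(1) w_L2 g_L2] by (intro L2_eqI) simp
  from L2_eq_trans[OF Sobolev_Suc_K_op[OF assms(1) Suc.prems] L2_eq_add[OF L2_eq_refl this]]
  have "L2_eq a b u (\<lambda>x. point_value a b u a + K_op a w x + K_op a ?g x)"
    by (simp add: add.assoc)
  moreover have "K_op a w \<in> poly_space a b (int (Suc r) - 1)"
    using poly_space_K_op[OF assms(1) w(1)] by simp
  then have "(\<lambda>x. point_value a b u a + K_op a w x) \<in> poly_space a b (int (Suc r) - 1)"
    by (intro poly_space_add poly_space_const) simp
  moreover have "K_op a ?g = (K_op a ^^ Suc r) (iterated_weak_deriv a b (Suc r) u)"
    by (simp add: funpow_swap1)
  ultimately show ?case
    by (intro bexI[of _ "\<lambda>x. point_value a b u a + K_op a w x"]) (simp_all only:)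
qed

text \<open>The value u(a) cancels, leaving K applied to the error for u'. Each step lowers q and t
  together, so t - q, and with it the space projected onto, never changes.\<close>

lemma Q_proj_error:
  assumes ab: "a < b" and Z0: "finite_dim_subspace a b Z0" and "q \<le> t" "u \<in> Sobolev a b q"
  defines "e \<equiv> L2_projection.residual a b (Z_space a b Z0 (t - q)) (iterated_weak_deriv a b q u)"
  shows "Q_proj a b Z0 q t u \<in> L2 a b"
    and "L2_eq a b (\<lambda>x. u x - Q_proj a b Z0 q t u x) ((K_op a ^^ q) e)"
proof -
  have "Q_proj a b Z0 q t u \<in> L2 a b \<and> L2_eq a b (\<lambda>x. u x - Q_proj a b Z0 q t u x)
     ((K_op a ^^ q) (L2_projection.residual a b (Z_space a b Z0 (t - q)) (iterated_weak_deriv a b q u)))"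
    using assms(3,4)
  proof (induction q arbitrary: t u)
    case 0
    interpret L2_projection a b "Z_space a b Z0 t" using ab Z0 by (rule L2_projection_Z_space)
    show ?case using 0 orth_proj_L2[OF Sobolev_L2] by (auto simp: Z_proj_def residual_def)
  next
    case (Suc q)
    then obtain t' where t: "t = Suc t'" "q \<le> t'" by (cases t) auto
    let ?D = "weak_deriv a b 1 u"
    let ?Q = "Q_proj a b Z0 q t' ?D"
    interpret L2_projection a b "Z_space a b Z0 (t' - q)" using ab Z0 by (rule L2_projection_Z_space)
    let ?e = "residual (iterated_weak_deriv a b q ?D)"
    have D: "?D \<in> Sobolev a b q" using Suc.prems(2) by (rule Sobolev_Suc_weak_deriv)
    have D_L2: "?D \<in> L2 a b" using D by (rule Sobolev_L2)
    have IH: "?Q \<in> L2 a b" "L2_eq a b (\<lambda>x. ?D x - ?Q x) ((K_op a ^^ q) ?e)"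
      using Suc.IH[OF t(2) D] by auto
    have "iterated_weak_deriv a b q ?D \<in> L2 a b"
      using Sobolev_iterated_weak_deriv[of ?D a b q 0] D by (auto intro: Sobolev_L2)
    then have e_L2: "(K_op a ^^ q) ?e \<in> L2 a b" using ab by (intro K_op_funpow_L2 residual_L2)
    have Q: "Q_proj a b Z0 (Suc q) t u = (\<lambda>x. point_value a b u a + K_op a ?Q x)"
      by (simp add: t)
    have "L2_eq a b (\<lambda>x. u x - Q_proj a b Z0 (Suc q) t u x)
      (\<lambda>x. (point_value a b u a + K_op a ?D x) - (point_value a b u a + K_op a ?Q x))"
      unfolding Q by (intro L2_eq_diff L2_eq_refl Sobolev_Suc_K_op[OF ab Suc.prems(2)])
    also have "L2_eq a b \<dots> (K_op a ((K_op a ^^ q) ?e))"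
      using K_op_cong[OF ab L2_diff[OF D_L2 IH(1)] e_L2 IH(2)] K_op_diff[OF ab D_L2 IH(1)]
      by (intro L2_eqI) simp
    finally have "L2_eq a b (\<lambda>x. u x - Q_proj a b Z0 (Suc q) t u x) (K_op a ((K_op a ^^ q) ?e))" .
    moreover have "Q_proj a b Z0 (Suc q) t u \<in> L2 a b"
      unfolding Q using ab IH(1) by (intro L2_add L2_const K_op_L2)
    ultimately show ?case by (simp add: t funpow_swap1)
  qed
  then show "Q_proj a b Z0 q t u \<in> L2 a b"
    "L2_eq a b (\<lambda>x. u x - Q_proj a b Z0 q t u x) ((K_op a ^^ q) e)"
    unfolding e_def by auto
qed

theorem theorem1:
  fixes a b :: real and Z0 :: "(real \<Rightarrow> real) set" and u :: "real \<Rightarrow> real"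
    and r q l t :: nat
  assumes "a < b"
    and "finite_dim_subspace a b Z0"
    and "poly_space a b 0 \<subseteq> Z0"
    and "\<And>k. L2_sum a b (poly_space a b 0) (K_op a ` Z_space a b Z0 k)
            = L2_sum a b (poly_space a b 0) (K_adj b ` Z_space a b Z0 k)"
    and "u \<in> Sobolev a b r"
    and "q \<le> r" and "l \<le> q" and "q \<le> t"
    and "poly_space a b (int r - int q - 1) \<subseteq> Z_space a b Z0 (t - q)"
    and "poly_space a b (int q - int l - 1) \<subseteq> Z_space a b Z0 (t - q)"
  shows "L2_norm a b (weak_deriv a b l (\<lambda>x. u x - Q_proj a b Z0 q t u x))
      \<le> C_const a b Z0 (t - q) (q - l) * C_const a b Z0 (t - q) (r - q)
         * L2_norm a b (weak_deriv a b r u)"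
proof -
  interpret L2_projection a b "Z_space a b Z0 (t - q)"
    using assms(1,2) by (rule L2_projection_Z_space)
  note C = C_const_eq[OF assms(1,2)]
  let ?v = "iterated_weak_deriv a b q u"
  let ?g = "iterated_weak_deriv a b r u"
  let ?e = "residual ?v"
  let ?err = "\<lambda>x. u x - Q_proj a b Z0 q t u x"
  have uq: "u \<in> Sobolev a b q" using assms(5,6) Sobolev_mono by blast
  have v: "?v \<in> Sobolev a b (r - q)"
    using assms(5,6) by (intro Sobolev_iterated_weak_deriv) simp
  have g: "?g = iterated_weak_deriv a b (r - q) ?v"
    using assms(6) by (metis comp_apply funpow_add le_add_diff_inverse2)
  have g_L2: "?g \<in> L2 a b"
    using Sobolev_iterated_weak_deriv[of u a b r 0] assms(5) by (auto intro: Sobolev_L2)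
  have D_L2: "weak_deriv a b r u \<in> L2 a b"
    using Sobolev_weak_deriv[OF assms(5), of r] by (simp add: has_weak_deriv_def)
  have norm_g: "L2_norm a b ?g = L2_norm a b (weak_deriv a b r u)"
    by (intro L2_norm_cong g_L2 D_L2 iterated_weak_deriv_eq assms(5))
  have v_L2: "?v \<in> L2 a b" using v by (rule Sobolev_L2)
  have e_L2: "?e \<in> L2 a b" using v_L2 by (rule residual_L2)
  have K_L2: "(K_op a ^^ (r - q)) ?g \<in> L2 a b" using ab g_L2 by (rule K_op_funpow_L2)

  obtain w where w: "w \<in> poly_space a b (int (r - q) - 1)"
      "L2_eq a b ?v (\<lambda>x. w x + (K_op a ^^ (r - q)) ?g x)"
    using Sobolev_Taylor[OF ab v] g by auto
  \<comment> \<open>The Taylor polynomial has degree at most r - q - 1, so it lies in the space and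
    leaves the residual unchanged.\<close>
  have "(\<lambda>x. ?v x - 1 * (K_op a ^^ (r - q)) ?g x) \<in> Z_space a b Z0 (t - q)"
  proof (rule V_cong)
    show "w \<in> Z_space a b Z0 (t - q)" using w(1) assms(6,9) by (auto simp: of_nat_diff)
    show "L2_eq a b (\<lambda>x. ?v x - 1 * (K_op a ^^ (r - q)) ?g x) w"
      using w(2) unfolding L2_eq_def by (rule eventually_mono) simp
    show "(\<lambda>x. ?v x - 1 * (K_op a ^^ (r - q)) ?g x) \<in> L2 a b"
      using v_L2 K_L2 by (intro L2_diff L2_scale)
  qed
  from residual_eq[OF v_L2 K_L2 this]
  have "L2_norm a b ?e = L2_norm a b (residual ((K_op a ^^ (r - q)) ?g))"
    using e_L2 K_L2 by (intro L2_norm_cong) (simp_all add: residual_L2)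
  also have "\<dots> \<le> error_const (r - q) * L2_norm a b ?g" using g_L2 by (rule error_const_bound)
  finally have e_le: "L2_norm a b ?e \<le> error_const (r - q) * L2_norm a b (weak_deriv a b r u)"
    unfolding norm_g .

  note Q = Q_proj_error[OF assms(1,2,8) uq]
  \<comment> \<open>Split q as l + (q - l): each derivative removes one K.\<close>
  have "has_weak_deriv a b l ((K_op a ^^ q) ?e) ((K_op a ^^ (q - l)) ?e)"
    using has_weak_deriv_K_op_funpow[OF ab e_L2, of l "q - l"] assms(7)
    by (simp only: le_add_diff_inverse)
  then have err: "has_weak_deriv a b l ?err ((K_op a ^^ (q - l)) ?e)"
    by (rule has_weak_deriv_cong[OF _ L2_diff[OF Sobolev_L2[OF uq] Q(1)] Q(2)])
  have "weak_deriv a b l ?err \<in> L2 a b"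
    using has_weak_deriv_weak_deriv[OF err] by (simp add: has_weak_deriv_def)
  then have "L2_norm a b (weak_deriv a b l ?err) = L2_norm a b ((K_op a ^^ (q - l)) ?e)"
    by (intro L2_norm_cong K_op_funpow_L2 ab e_L2 weak_deriv_L2_eq[OF err])
  \<comment> \<open>Here e enters only through its orthogonality to the space, which yields the
    second constant by duality.\<close>
  also have "\<dots> \<le> error_const (q - l) * L2_norm a b ?e"
    using e_L2 orth_proj(2)[OF v_L2] assms(7,10)
    by (intro L2_norm_K_op_orthogonal_le) (auto simp: of_nat_diff)
  also have "\<dots> \<le> error_const (q - l) * (error_const (r - q) * L2_norm a b (weak_deriv a b r u))"
    by (intro mult_left_mono e_le error_const_nonneg)
  finally show ?thesis unfolding C by (simp add: mult.assoc)
qed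

end
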